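(* In the up/down storage model described in the context, assume that there is a finite random variable $W(\infty)$ such that, for every $\alpha\ge 0$, $\frac1t\int_0^t e^{-\alpha W(s)}\,ds\to E e^{-\alpha W(\infty)}$ a.s. as $t\to\infty$, and that there is a constant $p_d$ such that $\frac1t\int_0^t J(s)\,ds\to p_d\le \frac{\varphi'(0)}{\eta'(0)+\varphi'(0)}$ a.s. as $t\to\infty$. Let $W_d,W_u,Y_e,I_\ell,I,\pi_\ell,\pi$ be as defined in the context, with $W_u,Y_e,I_\ell,I,W_d$ independent. Then the identity $$E e^{-\alpha W(\infty)}=\pi_\ell\,\frac{\varphi'(0)\alpha}{\varphi(\alpha)}+(1-\pi_\ell)\left(1-\pi+\pi\,\frac{\eta(\alpha)}{\eta'(0)\alpha}\,\frac{\varphi'(0)\alpha}{\varphi(\alpha)}\right)E e^{-\alpha W_d}\qquad(\alpha>0)$$ is equivalent to the equality in distribution $$W(\infty)\sim I_\ell W_u+(1-I_\ell)\left(I(W_u+Y_e)+W_d\right).$$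
   Context: Notation: $1_A$ is the indicator of $A$; $a^-=\min(a,0)$ (so $a^-\le 0$); a.s. means almost surely; $\sim$ means equality in distribution (or "is distributed as"); $g(t-)$ is the left limit of $g$ at $t$; derivatives at $0$ of functions on $[0,\infty)$ are right derivatives. Up/down storage model. Let $\{\mathcal F_t\mid t\ge 0\}$ be a standard filtration (right-continuous, complete) on a probability space. Let $(X_u,X_d)$ be a c\`adl\`ag two-dimensional L\'evy process with respect to $\{\mathcal F_t\}$, with components as follows. - $X_u$ is a one-dimensional L\'evy process with no negative jumps which is not a subordinator (not nondecreasing), with Laplace-Stieltjes exponent $\varphi(\alpha)=\log Ee^{-\alpha X_u(1)}$, $\alpha\ge 0$, $$\varphi(\alpha)=-c_u\alpha+\frac{\sigma_u^2\alpha^2}{2}+\int_{(0,\infty)}\left(e^{-\alpha x}-1+\alpha x1_{\{x\le 1\}}\right)\nu_u(dx),$$ and $EX_u(1)=-\varphi'(0)=c_u+\int_{(1,\infty)}x\,\nu_u(dx)<0$. - $X_d$ is a right-continuous subordinator (nondecreasing L\'evy process) with $Ee^{-\alpha X_d(1)}=e^{-\eta(\alpha)}$, $\alpha\ge0$, where $$\eta(\alpha)=c_d\alpha+\int_{(0,\infty)}(1-e^{-\alpha x})\,\nu_d(dx),\qquad c_d\ge 0,$$ and $EX_d(1)=\eta'(0)<\infty$. Let $0=T_0\le S_1\le T_1\le S_2\le T_2\le\cdots$ be a sequence of a.s. finite stopping times with respect to $\{\mathcal F_t\}$ with $T_{n-1}<T_n$ for all $n\ge1$ and $T_n\to\infty$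 a.s. The intervals $(T_{n-1},S_n]$ are called down periods and the intervals $(S_n,T_n]$ up periods. Set $N(t)=\sup\{n\mid T_n\le t\}$ and $J(t)=1_{\{S_{N(t)+1}>t\}}$, so $J=1$ during down periods and $J=0$ during up periods. Let $W(0)\ge 0$ be a finite $\mathcal F_0$-measurable random variable and define $$\tilde X_d(t)=\int_{(0,t]}J(s-)\,dX_d(s),\quad \tilde X_u(t)=\int_{(0,t]}(1-J(s-))\,dX_u(s),\quad \tilde X(t)=\tilde X_u(t)+\tilde X_d(t),$$ $$L(t)=-\inf_{0\le s\le t}\left(W(0)+\tilde X(s)\right)^-,\qquad W(t)=W(0)+\tilde X(t)+L(t).$$ Random variables and constants. Put $$\pi_\ell=1-\left(1+\frac{\eta'(0)}{\varphi'(0)}\right)p_d,\qquad \pi=\frac{\eta'(0)}{\eta'(0)+\varphi'(0)}.$$ - $W_d$ is a nonnegative random variable such that, if $p_d>0$, then for every $\alpha\ge0$, a.s. as $t\to\infty$, $\int_0^t e^{-\alpha W(s)}J(s)\,ds\big/\int_0^tJ(s)\,ds\to Ee^{-\alpha W_d}$ (such $W_d$ exists under the stated assumptions). - $W_u\sim\sup\{X_u(s)\mid s\ge0\}$, for which $Ee^{-\alpha W_u}=\alpha\varphi'(0)/\varphi(\alpha)$. - $Y_e$ has distribution function $F_e$ with $F_e(y)=0$ for $y<0$ and, for $y\ge0$, $F_e(y)=\frac{1}{c_d+\bar\nu_d}\left(c_d+\int_0^y\nu_d(x,\infty)\,dx\right)$, where $\bar\nu_d=\int_{(0,\infty)}x\,\nu_d(dx)$;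 here $c_d+\bar\nu_d=\eta'(0)$ and $Ee^{-\alpha Y_e}=\frac{\eta(\alpha)}{\eta'(0)\alpha}$. - $P(I_\ell=1)=1-P(I_\ell=0)=\pi_\ell$ and $P(I=1)=1-P(I=0)=\pi$. If $\eta'(0)=0$ (so $\pi=0$), terms with factor $\pi$ are read as $0$ and $Y_e$ may be taken to be any finite nonnegative random variable. *)

theory Defs
  imports "HOL-Probability.Probability"
begin

section \<open>Levy processes\<close>

definition cadlag :: "(real \<Rightarrow> 'b::topological_space) \<Rightarrow> bool" where
  "cadlag x \<longleftrightarrow> (\<forall>t\<ge>0. continuous (at_right t) x) \<and> (\<forall>t>0. \<exists>l. (x \<longlongrightarrow> l) (at_left t))"

definition left_lim :: "(real \<Rightarrow> 'b::t2_space) \<Rightarrow> real \<Rightarrow> 'b" where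
  "left_lim x t = Lim (at_left t) x"

definition no_negative_jumps :: "(real \<Rightarrow> real) \<Rightarrow> bool" where
  "no_negative_jumps x \<longleftrightarrow> (\<forall>t>0. left_lim x t \<le> x t)"

text \<open>Filtrations are indexed by \<open>[0,\<infinity>]\<close>, so that stopping times may be infinite on a null set;
  the sigma-algebra at \<open>\<infinity>\<close> plays no role.\<close>

locale standard_filtration = prob_space M + complete_measure M + filtration "space M" F
  for M :: "'a measure" and F :: "ennreal \<Rightarrow> 'a measure" +
  assumes sets_F_subset: "sets (F t) \<subseteq> sets M"
    and null_sets_F: "null_sets M \<subseteq> sets (F 0)"
    and right_continuous_F: "t < \<infinity> \<Longrightarrow> sets (F t) = (\<Inter>s\<in>{t<..}. sets (F s))"

definition levy_process ::
    "'a measure \<Rightarrow> (ennreal \<Rightarrow> 'a measure) \<Rightarrow> (real \<Rightarrow> 'a \<Rightarrow> 'b::euclidean_space) \<Rightarrow> bool" where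
  "levy_process M F X \<longleftrightarrow>
     (\<forall>t\<ge>0. X t \<in> borel_measurable (F (ennreal t))) \<and>
     (AE \<omega> in M. X 0 \<omega> = 0) \<and>
     (AE \<omega> in M. cadlag (\<lambda>t. X t \<omega>)) \<and>
     (\<forall>s t. 0 \<le> s \<and> s \<le> t \<longrightarrow>
        prob_space.indep_set M (sets (F (ennreal s)))
          {(\<lambda>\<omega>. X t \<omega> - X s \<omega>) -` A \<inter> space M | A. A \<in> sets borel} \<and>
        distr M borel (\<lambda>\<omega>. X t \<omega> - X s \<omega>) = distr M borel (X (t - s)))"

definition upward_levy_measure :: "real measure \<Rightarrow> bool" where
  "upward_levy_measure \<nu> \<longleftrightarrow>
     sets \<nu> = sets borel \<and> emeasure \<nu> {..0} = 0 \<and> integrable \<nu> (\<lambda>x. min 1 (x\<^sup>2))"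

definition subordinator_levy_measure :: "real measure \<Rightarrow> bool" where
  "subordinator_levy_measure \<nu> \<longleftrightarrow>
     sets \<nu> = sets borel \<and> emeasure \<nu> {..0} = 0 \<and> integrable \<nu> (\<lambda>x. min 1 x)"

definition up_exponent :: "real \<Rightarrow> real \<Rightarrow> real measure \<Rightarrow> real \<Rightarrow> real" where
  "up_exponent c \<sigma> \<nu> \<alpha> = - c * \<alpha> + \<sigma>\<^sup>2 * \<alpha>\<^sup>2 / 2 +
     (LINT x:{0<..}|\<nu>. exp (- \<alpha> * x) - 1 + \<alpha> * x * indicator {..1} x)"

definition down_exponent :: "real \<Rightarrow> real measure \<Rightarrow> real \<Rightarrow> real" where
  "down_exponent c \<nu> \<alpha> = c * \<alpha> + (LINT x:{0<..}|\<nu>. 1 - exp (- \<alpha> * x))"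

definition right_deriv_0 :: "(real \<Rightarrow> real) \<Rightarrow> real" where
  "right_deriv_0 f = vector_derivative f (at 0 within {0..})"

definition excess_cdf :: "real \<Rightarrow> real measure \<Rightarrow> real \<Rightarrow> real" where
  "excess_cdf c \<nu> y = (if y < 0 then 0 else
     1 / (c + (LINT x:{0<..}|\<nu>. x)) * (c + (LINT x:{0..y}|lborel. measure \<nu> {x<..})))"


section \<open>The storage process, path by path\<close>

text \<open>\<open>T n\<close> is the end of the \<open>n\<close>-th up period and \<open>S n\<close>, for \<open>n \<ge> 1\<close>, the end of the
  \<open>n\<close>-th down period; the value \<open>S 0\<close> is never used.\<close>

definition cycle_count :: "(nat \<Rightarrow> ennreal) \<Rightarrow> real \<Rightarrow> nat" where
  "cycle_count T t = Sup {n. T n \<le> ennreal t}"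

definition down_indicator :: "(nat \<Rightarrow> ennreal) \<Rightarrow> (nat \<Rightarrow> ennreal) \<Rightarrow> real \<Rightarrow> real" where
  "down_indicator T S t = (if S (Suc (cycle_count T t)) > ennreal t then 1 else 0)"

definition switch_times :: "(nat \<Rightarrow> ennreal) \<Rightarrow> (nat \<Rightarrow> ennreal) \<Rightarrow> nat \<Rightarrow> ennreal" where
  "switch_times T S k = (if even k then T (k div 2) else S (Suc (k div 2)))"

text \<open>The stochastic integral over \<open>(0,t]\<close> of an integrand \<open>H\<close> that is constant on each of the
  intervals \<open>(\<tau> k, \<tau> (k+1)]\<close>, where \<open>\<tau>\<close> increases from \<open>0\<close> to \<open>\<infinity>\<close>. For such \<open>H\<close> it is
  the pathwise sum of the increments of the integrator, weighted with the value of \<open>H\<close> on the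
  interval.\<close>

definition step_integral ::
    "(nat \<Rightarrow> ennreal) \<Rightarrow> (real \<Rightarrow> real) \<Rightarrow> (real \<Rightarrow> real) \<Rightarrow> real \<Rightarrow> real" where
  "step_integral \<tau> H x t = (\<Sum>k | \<tau> k < ennreal t.
     let r = enn2real (min (\<tau> (Suc k)) (ennreal t)) in H r * (x r - x (enn2real (\<tau> k))))"

definition net_input ::
    "(nat \<Rightarrow> ennreal) \<Rightarrow> (nat \<Rightarrow> ennreal) \<Rightarrow> (real \<Rightarrow> real) \<Rightarrow> (real \<Rightarrow> real) \<Rightarrow> real \<Rightarrow> real" where
  "net_input T S xu xd t =
     step_integral (switch_times T S) (\<lambda>s. 1 - left_lim (down_indicator T S) s) xu t +
     step_integral (switch_times T S) (left_lim (down_indicator T S)) xd t"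

definition reflection_term :: "real \<Rightarrow> (real \<Rightarrow> real) \<Rightarrow> real \<Rightarrow> real" where
  "reflection_term w x t = - (INF s\<in>{0..t}. min (w + x s) 0)"

definition storage_content ::
    "(nat \<Rightarrow> ennreal) \<Rightarrow> (nat \<Rightarrow> ennreal) \<Rightarrow> (real \<Rightarrow> real) \<Rightarrow> (real \<Rightarrow> real) \<Rightarrow> real \<Rightarrow> real \<Rightarrow> real" where
  "storage_content T S xu xd w t =
     w + net_input T S xu xd t + reflection_term w (net_input T S xu xd) t"

text \<open>The integrand \<open>J(s-)\<close> is indeed a step function on the switching grid.\<close>

lemma cycle_count_eq:
  assumes "\<And>n. T n < T (Suc n)" and "T n \<le> ennreal t" and "ennreal t < T (Suc n)"
  shows "cycle_count T t = n"
proof -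
  have mono: "strict_mono T"
    using assms(1) by (simp add: strict_mono_Suc_iff)
  have "{m. T m \<le> ennreal t} = {..n}"
  proof (intro set_eqI iffI)
    fix m assume "m \<in> {m. T m \<le> ennreal t}"
    then have "T m < T (Suc n)" using assms(3) by (auto intro: le_less_trans)
    then show "m \<in> {..n}" using strict_mono_less[OF mono] by auto
  next
    fix m assume "m \<in> {..n}"
    then have "T m \<le> T n" using strict_mono_less_eq[OF mono] by auto
    then show "m \<in> {m. T m \<le> ennreal t}" using assms(2) by auto
  qed
  then show ?thesis
    unfolding cycle_count_def by (simp add: cSup_eq_maximum)
qed

lemma eventually_at_left_ennreal:
  assumes "a < ennreal s"
  shows "eventually (\<lambda>t. 0 \<le> t \<and> a < ennreal t \<and> ennreal t < ennreal s) (at_left s)"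
proof -
  have a: "a = ennreal (enn2real a)"
    using assms by (metis ennreal_enn2real less_top order.strict_trans2 top_greatest)
  have "enn2real a < s"
    using assms a enn2real_nonneg by (metis ennreal_less_iff)
  then have "eventually (\<lambda>t. t \<in> {enn2real a<..<s}) (at_left s)"
    by (rule eventually_at_left_real)
  then show ?thesis
  proof eventually_elim
    case (elim t)
    then have at: "enn2real a < t" "t < s" by auto
    moreover from at have "0 \<le> t" using enn2real_nonneg[of a] by linarith
    ultimately show ?case using a enn2real_nonneg[of a]
      by (metis ennreal_less_iff)
  qed
qed

lemma left_lim_down_indicator:
  assumes "\<And>n. T n < T (Suc n)" and "T n \<le> S (Suc n)" and "S (Suc n) \<le> T (Suc n)"
  shows "T n < ennreal s \<Longrightarrow> ennreal s \<le> S (Suc n) \<Longrightarrow> left_lim (down_indicator T S) s = 1"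
    and "S (Suc n) < ennreal s \<Longrightarrow> ennreal s \<le> T (Suc n) \<Longrightarrow> left_lim (down_indicator T S) s = 0"
proof -
  assume *: "T n < ennreal s" "ennreal s \<le> S (Suc n)"
  have "eventually (\<lambda>t. down_indicator T S t = 1) (at_left s)"
    using eventually_at_left_ennreal[OF *(1)]
  proof eventually_elim
    case (elim t)
    then have "cycle_count T t = n"
      using assms(3) * by (intro cycle_count_eq assms(1)) auto
    then show ?case using elim * by (auto simp: down_indicator_def)
  qed
  then have "(down_indicator T S \<longlongrightarrow> 1) (at_left s)"
    by (rule tendsto_eventually)
  then show "left_lim (down_indicator T S) s = 1"
    unfolding left_lim_def by (intro tendsto_Lim) auto
next
  assume *: "S (Suc n) < ennreal s" "ennreal s \<le> T (Suc n)"
  have "eventually (\<lambda>t. down_indicator T S t = 0) (at_left s)"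
    using eventually_at_left_ennreal[OF *(1)]
  proof eventually_elim
    case (elim t)
    then have "cycle_count T t = n"
      using assms(2) * by (intro cycle_count_eq assms(1)) auto
    then show ?case using elim * by (auto simp: down_indicator_def)
  qed
  then have "(down_indicator T S \<longlongrightarrow> 0) (at_left s)"
    by (rule tendsto_eventually)
  then show "left_lim (down_indicator T S) s = 0"
    unfolding left_lim_def by (intro tendsto_Lim) auto
qed


section \<open>The up/down storage model\<close>

locale up_down_storage = standard_filtration M F
  for M :: "'a measure" and F :: "ennreal \<Rightarrow> 'a measure" +
  fixes X\<^sub>u X\<^sub>d :: "real \<Rightarrow> 'a \<Rightarrow> real"
    and c\<^sub>u \<sigma>\<^sub>u :: real and \<nu>\<^sub>u :: "real measure"
    and c\<^sub>d :: real and \<nu>\<^sub>d :: "real measure"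
    and T S :: "nat \<Rightarrow> 'a \<Rightarrow> ennreal"
    and W\<^sub>0 :: "'a \<Rightarrow> real"
  assumes levy: "levy_process M F (\<lambda>t \<omega>. (X\<^sub>u t \<omega>, X\<^sub>d t \<omega>))"
    and up_jumps: "AE \<omega> in M. no_negative_jumps (\<lambda>t. X\<^sub>u t \<omega>)"
    and up_not_subordinator: "\<not> (AE \<omega> in M. mono_on {0..} (\<lambda>t. X\<^sub>u t \<omega>))"
    and up_levy_measure: "upward_levy_measure \<nu>\<^sub>u"
    and up_laplace: "0 \<le> \<alpha> \<Longrightarrow> integrable M (\<lambda>\<omega>. exp (- \<alpha> * X\<^sub>u 1 \<omega>))"
      "0 \<le> \<alpha> \<Longrightarrow> ln (\<integral>\<omega>. exp (- \<alpha> * X\<^sub>u 1 \<omega>) \<partial>M) = up_exponent c\<^sub>u \<sigma>\<^sub>u \<nu>\<^sub>u \<alpha>"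
    and up_mean: "integrable M (X\<^sub>u 1)" "(\<integral>\<omega>. X\<^sub>u 1 \<omega> \<partial>M) < 0"
    and down_subordinator: "AE \<omega> in M. mono_on {0..} (\<lambda>t. X\<^sub>d t \<omega>)"
    and down_drift: "0 \<le> c\<^sub>d"
    and down_levy_measure: "subordinator_levy_measure \<nu>\<^sub>d"
    and down_laplace: "0 \<le> \<alpha> \<Longrightarrow>
      (\<integral>\<omega>. exp (- \<alpha> * X\<^sub>d 1 \<omega>) \<partial>M) = exp (- down_exponent c\<^sub>d \<nu>\<^sub>d \<alpha>)"
    and down_mean: "integrable M (X\<^sub>d 1)"
    and stopping: "stopping_time F (T n)" "stopping_time F (S (Suc n))"
    and finite_times: "AE \<omega> in M. T n \<omega> < \<infinity>" "AE \<omega> in M. S (Suc n) \<omega> < \<infinity>"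
    and T_0: "AE \<omega> in M. T 0 \<omega> = 0"
    and interlacing: "AE \<omega> in M. T n \<omega> \<le> S (Suc n) \<omega>" "AE \<omega> in M. S (Suc n) \<omega> \<le> T (Suc n) \<omega>"
    and T_less: "AE \<omega> in M. T n \<omega> < T (Suc n) \<omega>"
    and T_unbounded: "AE \<omega> in M. (\<lambda>n. T n \<omega>) \<longlonglongrightarrow> \<infinity>"
    and initial: "W\<^sub>0 \<in> borel_measurable (F 0)" "AE \<omega> in M. 0 \<le> W\<^sub>0 \<omega>"

end

theory Submission
  imports Defs "HOL-Real_Asymp.Real_Asymp"
begin

text \<open>The right-hand side of the identity is the Laplace transform of the mixture on the right-hand
  side of the equality in distribution, so the equivalence is an instance of the uniqueness of Laplace
  transforms of nonnegative random variables (\<open>laplace_transforms_eq_iff_distr_eq\<close>). That \<open>W\<^sub>i\<^sub>n\<^sub>f\<close> is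
  nonnegative can be read off the identity itself: a transform that stays below \<open>1\<close> on \<open>(0,\<infinity>)\<close> leaves no
  mass on the negative half-line.

  On the almost sure event where both indicators are \<open>0\<close> or \<open>1\<close> the exponential of the mixture is a sum of
  three products of functions of the five independent variables (\<open>mixture_laplace_transform\<close>). It remains
  to know two transforms.

  For \<open>W\<^sub>u\<close>, the supremum of a Levy process without negative jumps and with negative drift, the transform is
  the generalized Pollaczek-Khinchine formula \<open>\<alpha> \<phi>'(0) / \<phi>(\<alpha>)\<close>. It is derived from random walks. For the
  skeleton of mesh \<open>h\<close> let \<open>M\<close> be the supremum, \<open>\<xi>\<close> an independent step and \<open>V\<close> the negative part of
  \<open>\<xi> + M\<close>. As \<open>M\<close> is distributed as \<open>max 0 (\<xi> + M)\<close>,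
  \<open>E exp(-\<alpha>M) (exp(h\<phi>(\<alpha>)) - 1) = E(exp(\<alpha>V) - 1)\<close>. Dividing by \<open>\<alpha>\<close> and letting \<open>\<alpha> \<rightarrow> 0\<close> identifies \<open>E V\<close>
  with \<open>h\<phi>'(0)\<close>. As there are no negative jumps, \<open>\<phi>\<close> grows at most quadratically, so a Chernoff bound shows
  that \<open>V\<close> is small up to an event of probability \<open>o(h)\<close>. Hence \<open>E(exp(\<alpha>V) - 1)\<close> differs from \<open>\<alpha> h \<phi>'(0)\<close>
  by \<open>o(h)\<close>, and dividing by \<open>h\<close> gives the formula in the limit \<open>h \<rightarrow> 0\<close>. All
  estimates are made for finitely many steps, where the maximum is finite; finiteness of the supremum is a
  consequence of the formula, because its right-hand side tends to \<open>1\<close> as \<open>\<alpha> \<rightarrow> 0\<close>.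

  For \<open>Y\<^sub>e\<close> the transform is obtained by applying one Tonelli identity for tails, \<open>nn_integral_tail\<close>, three
  times: to the law of \<open>Y\<^sub>e\<close>, to the measure whose density is the tail of the Levy measure, and to the Levy
  measure itself.\<close>

section \<open>Laplace transforms\<close>

text \<open>The moments are at most \<open>1\<close>, so the moment expansion of the characteristic function has an error
  that vanishes with the number of terms, and moments determine characteristic functions.\<close>

lemma moments_unit_interval_unique:
  fixes \<mu> \<nu> :: "real measure"
  assumes "real_distribution \<mu>" "real_distribution \<nu>"
    and mu01: "AE x in \<mu>. x \<in> {0..1}" and nu01: "AE x in \<nu>. x \<in> {0..1}"
    and moments: "\<And>k. (LINT x|\<mu>. x ^ k) = (LINT x|\<nu>. x ^ k)"
  shows "\<mu> = \<nu>"
proof (rule Levy_uniqueness)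
  have approx: "cmod (char \<kappa> t - (\<Sum>k\<le>n. (\<i> * t) ^ k / fact k * (LINT x|\<kappa>. x ^ k))) \<le> 2 * \<bar>t\<bar> ^ n / fact n"
    if \<kappa>: "real_distribution \<kappa>" and AE01: "AE x in \<kappa>. x \<in> {0..1}" for \<kappa> t n
  proof -
    interpret K: real_distribution \<kappa> by fact
    have int: "integrable \<kappa> (\<lambda>x. x ^ k)" for k
    proof (rule K.integrable_const_bound[where B=1])
      show "AE x in \<kappa>. norm (x ^ k) \<le> 1"
        using AE01 by eventually_elim (simp add: power_le_one)
    qed simp
    have "(LINT x|\<kappa>. \<bar>x\<bar> ^ n) \<le> (LINT x|\<kappa>. 1)"
    proof (rule integral_mono_AE)
      show "AE x in \<kappa>. \<bar>x\<bar> ^ n \<le> 1"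
        using AE01 by eventually_elim (simp add: power_le_one)
    qed (use integrable_abs[OF int[of n]] in \<open>simp_all add: power_abs\<close>)
    also have "\<dots> = 1"
      by (simp add: K.prob_space[unfolded K.space_eq_univ])
    finally have "(LINT x|\<kappa>. \<bar>x\<bar> ^ n) \<le> 1" .
    then have "(2 * \<bar>t\<bar> ^ n / fact n) * (LINT x|\<kappa>. \<bar>x\<bar> ^ n) \<le> (2 * \<bar>t\<bar> ^ n / fact n) * 1"
      by (intro mult_left_mono) auto
    with K.char_approx1[where n=n and t=t, OF int] show ?thesis by simp
  qed
  show "char \<mu> = char \<nu>"
  proof
    fix t
    have "cmod (char \<mu> t - char \<nu> t) \<le> 4 * (\<bar>t\<bar> ^ n / fact n)" for n
    proof -
      define s where "s = (\<Sum>k\<le>n. (\<i> * t) ^ k / fact k * (LINT x|\<nu>. x ^ k))"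
      have "cmod (char \<mu> t - s) \<le> 2 * \<bar>t\<bar> ^ n / fact n" "cmod (char \<nu> t - s) \<le> 2 * \<bar>t\<bar> ^ n / fact n"
        using approx[OF assms(1) mu01, where n=n and t=t] approx[OF assms(2) nu01, where n=n and t=t]
        by (simp_all add: s_def moments)
      moreover have "cmod (char \<mu> t - char \<nu> t) \<le> cmod (char \<mu> t - s) + cmod (char \<nu> t - s)"
        using norm_triangle_ineq4[of "char \<mu> t - s" "char \<nu> t - s"] by simp
      ultimately show ?thesis by simp
    qed
    moreover have "(\<lambda>n. 4 * (\<bar>t\<bar> ^ n / fact n)) \<longlonglongrightarrow> 4 * 0"
      using summable_LIMSEQ_zero[OF summable_exp[of "\<bar>t\<bar>"]]
      by (intro tendsto_mult tendsto_const) (simp add: field_simps)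
    ultimately have "cmod (char \<mu> t - char \<nu> t) \<le> 4 * 0"
      by (intro LIMSEQ_le_const) auto
    then show "char \<mu> t = char \<nu> t" by simp
  qed
qed fact+

text \<open>Under the substitution \<open>y = exp (- x)\<close> the transform at the natural number \<open>k\<close> becomes the \<open>k\<close>-th
  moment of a law on the unit interval.\<close>

lemma laplace_transform_unique:
  fixes \<mu> \<nu> :: "real measure"
  assumes "real_distribution \<mu>" "real_distribution \<nu>"
    and nonneg: "AE x in \<mu>. 0 \<le> x" "AE x in \<nu>. 0 \<le> x"
    and laplace: "\<And>\<alpha>. 0 < \<alpha> \<Longrightarrow> (LINT x|\<mu>. exp (- \<alpha> * x)) = (LINT x|\<nu>. exp (- \<alpha> * x))"
  shows "\<mu> = \<nu>"
proof -
  interpret A: real_distribution \<mu> by fact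
  interpret B: real_distribution \<nu> by fact
  have [measurable]: "(\<lambda>x::real. exp (- x)) \<in> borel_measurable borel" by measurable
  have "distr \<mu> borel (\<lambda>x. exp (- x)) = distr \<nu> borel (\<lambda>x. exp (- x))"
  proof (rule moments_unit_interval_unique)
    show "(LINT y|distr \<mu> borel (\<lambda>x. exp (- x)). y ^ k) = (LINT y|distr \<nu> borel (\<lambda>x. exp (- x)). y ^ k)" for k
      using laplace[of "real k"] A.prob_space B.prob_space
      by (cases "k = 0") (simp_all add: integral_distr exp_of_nat_mult[symmetric] measure_distr)
    show "AE y in distr \<mu> borel (\<lambda>x. exp (- x)). y \<in> {0..1}"
      using nonneg by (simp add: AE_distr_iff)
    show "AE y in distr \<nu> borel (\<lambda>x. exp (- x)). y \<in> {0..1}"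
      using nonneg by (simp add: AE_distr_iff)
  qed (auto intro!: A.real_distribution_distr B.real_distribution_distr)
  then have "distr (distr \<mu> borel (\<lambda>x. exp (- x))) borel (\<lambda>y. - ln y) =
      distr (distr \<nu> borel (\<lambda>x. exp (- x))) borel (\<lambda>y. - ln y)" by simp
  moreover have "distr (distr \<kappa> borel (\<lambda>x. exp (- x))) borel (\<lambda>y. - ln y) = \<kappa>"
    if "sets \<kappa> = sets borel" for \<kappa> :: "real measure"
  proof -
    have [measurable]: "(\<lambda>x::real. exp (- x)) \<in> borel_measurable \<kappa>"
      using that by (subst measurable_cong_sets[OF that refl]) simp
    show ?thesis
      by (subst distr_distr) (auto simp: comp_def distr_id2 that)
  qed
  ultimately show ?thesis by simp
qed

text \<open>Mass \<open>p\<close> below \<open>- \<epsilon>\<close> would contribute at least \<open>p exp (\<alpha> \<epsilon>)\<close> to the transform, which is unbounded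
  in \<open>\<alpha>\<close>.\<close>

lemma (in prob_space) nonneg_if_laplace_le_1:
  fixes X :: "'a \<Rightarrow> real"
  assumes [measurable]: "random_variable borel X"
    and int: "\<And>\<alpha>. 0 < \<alpha> \<Longrightarrow> integrable M (\<lambda>\<omega>. exp (- \<alpha> * X \<omega>))"
    and le: "\<And>\<alpha>. 0 < \<alpha> \<Longrightarrow> expectation (\<lambda>\<omega>. exp (- \<alpha> * X \<omega>)) \<le> 1"
  shows "AE \<omega> in M. 0 \<le> X \<omega>"
proof -
  have "AE \<omega> in M. \<not> X \<omega> \<le> - 1 / Suc n" for n
  proof -
    have bound: "prob {\<omega>\<in>space M. X \<omega> \<le> - 1 / Suc n} \<le> exp (- (real k / Suc n))" if "0 < k" for k :: nat
    proof -
      have "exp (k / Suc n) \<le> exp (- real k * X \<omega>)" if "X \<omega> \<le> - 1 / Suc n" for \<omega>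
        using mult_left_mono[OF that, of "real k"] by simp
      then have "prob {\<omega>\<in>space M. X \<omega> \<le> - 1 / Suc n} \<le>
          prob {\<omega>\<in>space M. exp (k / Suc n) \<le> exp (- real k * X \<omega>)}"
        by (intro finite_measure_mono Collect_mono) simp_all
      also have "\<dots> \<le> expectation (\<lambda>\<omega>. exp (- real k * X \<omega>)) / exp (k / Suc n)"
        using that by (intro integral_Markov_inequality_measure[OF int, where A="{}"]) auto
      also have "\<dots> \<le> 1 / exp (k / Suc n)"
        using that by (intro divide_right_mono le) auto
      finally show ?thesis by (simp add: exp_minus field_simps)
    qed
    have "(\<lambda>k. exp (- (real k / Suc n))) \<longlonglongrightarrow> 0" by real_asymp
    then have "prob {\<omega>\<in>space M. X \<omega> \<le> - 1 / Suc n} \<le> 0"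
      by (rule LIMSEQ_le_const) (use bound in \<open>force intro!: exI[of _ 1]\<close>)
    then have "prob {\<omega>\<in>space M. X \<omega> \<le> - 1 / Suc n} = 0"
      by (simp add: measure_le_0_iff)
    then have "AE \<omega> in M. \<omega> \<notin> {\<omega>\<in>space M. X \<omega> \<le> - 1 / Suc n}"
      by (subst (asm) prob_eq_0) auto
    with AE_space show ?thesis by eventually_elim auto
  qed
  then have "AE \<omega> in M. \<forall>n. \<not> X \<omega> \<le> - 1 / Suc n" by (simp add: AE_all_countable)
  then show ?thesis
  proof eventually_elim
    case (elim \<omega>)
    show ?case
    proof (rule ccontr)
      assume "\<not> 0 \<le> X \<omega>"
      then obtain n where "1 / Suc n < - X \<omega>"
        using nat_approx_posE[of "- X \<omega>"] by auto
      with elim[rule_format, of n] show False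
        unfolding minus_divide_left[symmetric] by linarith
    qed
  qed
qed

text \<open>Only one of the two variables has to be known to be nonnegative: equality of the transforms
  forces the other one to be nonnegative too.\<close>

lemma laplace_transforms_eq_iff_distr_eq:
  fixes X :: "'a \<Rightarrow> real" and Y :: "'b \<Rightarrow> real"
  assumes "prob_space M" and X [measurable]: "X \<in> borel_measurable M"
    and int: "\<And>\<alpha>. 0 \<le> \<alpha> \<Longrightarrow> integrable M (\<lambda>\<omega>. exp (- \<alpha> * X \<omega>))"
    and "prob_space N" and Y [measurable]: "Y \<in> borel_measurable N" and nonneg: "AE \<omega> in N. 0 \<le> Y \<omega>"
  shows "(\<forall>\<alpha>>0. (LINT \<omega>|M. exp (- \<alpha> * X \<omega>)) = (LINT \<omega>|N. exp (- \<alpha> * Y \<omega>))) \<longleftrightarrow>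
    distr M borel X = distr N borel Y"
proof
  interpret M: prob_space M by fact
  interpret N: prob_space N by fact
  have X_law: "(LINT \<omega>|M. exp (- \<alpha> * X \<omega>)) = (LINT x|distr M borel X. exp (- \<alpha> * x))"
    and Y_law: "(LINT \<omega>|N. exp (- \<alpha> * Y \<omega>)) = (LINT x|distr N borel Y. exp (- \<alpha> * x))" for \<alpha>
    by (subst integral_distr; simp)+
  show "\<forall>\<alpha>>0. (LINT \<omega>|M. exp (- \<alpha> * X \<omega>)) = (LINT \<omega>|N. exp (- \<alpha> * Y \<omega>))"
    if "distr M borel X = distr N borel Y"
    unfolding X_law Y_law that by blast
  assume eq: "\<forall>\<alpha>>0. (LINT \<omega>|M. exp (- \<alpha> * X \<omega>)) = (LINT \<omega>|N. exp (- \<alpha> * Y \<omega>))"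
  have X_nonneg: "AE \<omega> in M. 0 \<le> X \<omega>"
  proof (rule M.nonneg_if_laplace_le_1[OF X])
    fix \<alpha> :: real assume \<alpha>: "0 < \<alpha>"
    show "integrable M (\<lambda>\<omega>. exp (- \<alpha> * X \<omega>))"
      using \<alpha> by (intro int) simp
    have "(LINT \<omega>|N. exp (- \<alpha> * Y \<omega>)) \<le> (LINT \<omega>|N. 1)"
      using \<alpha> by (intro integral_mono_AE' eventually_mono[OF nonneg]) auto
    then show "(LINT \<omega>|M. exp (- \<alpha> * X \<omega>)) \<le> 1"
      using eq \<alpha> by (simp add: N.prob_space)
  qed
  show "distr M borel X = distr N borel Y"
  proof (rule laplace_transform_unique)
    show "(LINT x|distr M borel X. exp (- \<alpha> * x)) = (LINT x|distr N borel Y. exp (- \<alpha> * x))" if "0 < \<alpha>" for \<alpha>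
      using eq that unfolding X_law Y_law by blast
    show "AE x in distr M borel X. 0 \<le> x" "AE x in distr N borel Y. 0 \<le> x"
      using X_nonneg nonneg by (simp_all add: AE_distr_iff)
  qed (auto intro: M.real_distribution_distr N.real_distribution_distr)
qed

text \<open>The upper bound is convexity of \<open>exp\<close> between \<open>0\<close> and \<open>x\<close>. Together the bounds sandwich the difference
  quotient in \<open>a\<close> between two expressions that do not depend on \<open>a\<close>.\<close>

lemma exp_minus_one_bounds:
  fixes x a :: real
  assumes "0 \<le> a" "a \<le> 1"
  shows "a * x \<le> exp (a * x) - 1" and "exp (a * x) - 1 \<le> a * (exp x - 1)"
proof -
  show "a * x \<le> exp (a * x) - 1" using exp_ge_add_one_self[of "a * x"] by linarith
  have "exp ((1 - a) *\<^sub>R 0 + a *\<^sub>R x) \<le> (1 - a) * exp 0 + a * exp x"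
    using assms by (intro convex_onD[OF exp_convex]) auto
  then show "exp (a * x) - 1 \<le> a * (exp x - 1)" by (simp add: algebra_simps)
qed

lemma tendsto_exp_diff_quotient: "((\<lambda>\<alpha>. (exp (- \<alpha> * x) - 1) / \<alpha>) \<longlongrightarrow> - x) (at_right 0)" for x :: real
  by real_asymp

text \<open>Dominated convergence applies since by convexity the difference quotients lie between \<open>- X\<close> and
  \<open>exp (- X) - 1\<close>.\<close>

lemma laplace_transform_deriv_0:
  fixes X :: "'a \<Rightarrow> real"
  assumes "prob_space M"
    and X: "integrable M X" and int: "integrable M (\<lambda>\<omega>. exp (- X \<omega>))"
  shows "((\<lambda>\<alpha>. ((LINT \<omega>|M. exp (- \<alpha> * X \<omega>)) - 1) / \<alpha>) \<longlongrightarrow> - (LINT \<omega>|M. X \<omega>)) (at_right 0)"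
proof -
  interpret prob_space M by fact
  have [measurable]: "X \<in> borel_measurable M" using X by simp
  have bound: "\<bar>(exp (- \<alpha> * x) - 1) / \<alpha>\<bar> \<le> \<bar>x\<bar> + exp (- x) + 1" if "0 < \<alpha>" "\<alpha> \<le> 1" for \<alpha> x :: real
  proof -
    have "- x \<le> (exp (- \<alpha> * x) - 1) / \<alpha>"
      using exp_minus_one_bounds(1)[of \<alpha> "- x"] that by (simp add: field_simps)
    moreover have "(exp (- \<alpha> * x) - 1) / \<alpha> \<le> exp (- x) - 1"
      using exp_minus_one_bounds(2)[of \<alpha> "- x"] that by (simp add: field_simps)
    ultimately show ?thesis using exp_gt_zero[of "- x"] by linarith
  qed
  have int_\<alpha>: "integrable M (\<lambda>\<omega>. exp (- \<alpha> * X \<omega>))" if "0 < \<alpha>" "\<alpha> \<le> 1" for \<alpha>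
  proof (rule Bochner_Integration.integrable_bound[OF Bochner_Integration.integrable_add[OF int integrable_const[of 1]]])
    show "AE \<omega> in M. norm (exp (- \<alpha> * X \<omega>)) \<le> norm (exp (- X \<omega>) + 1)"
    proof (rule AE_I2)
      fix \<omega>
      have "exp (- \<alpha> * X \<omega>) \<le> 1 + \<alpha> * (exp (- X \<omega>) - 1)"
        using exp_minus_one_bounds(2)[of \<alpha> "- X \<omega>"] that by simp
      also have "\<dots> \<le> 1 + exp (- X \<omega>)"
      proof -
        have "\<alpha> * exp (- X \<omega>) \<le> exp (- X \<omega>)"
          by (rule mult_left_le_one_le) (use that in auto)
        then have "\<alpha> * exp (- X \<omega>) - \<alpha> * 1 \<le> exp (- X \<omega>)"
          using that by linarith
        then show ?thesis
          unfolding right_diff_distrib by linarith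
      qed
      finally show "norm (exp (- \<alpha> * X \<omega>)) \<le> norm (exp (- X \<omega>) + 1)" by simp
    qed
  qed simp
  have "((\<lambda>\<alpha>. LINT \<omega>|M. (exp (- \<alpha> * X \<omega>) - 1) / \<alpha>) \<longlongrightarrow> (LINT \<omega>|M. - X \<omega>)) (at_right 0)"
    unfolding tendsto_at_iff_sequentially comp_def
  proof safe
    fix s :: "nat \<Rightarrow> real" assume s: "\<forall>i. s i \<in> {0<..} - {0}" "s \<longlonglongrightarrow> 0"
    then have "eventually (\<lambda>i. s i < 1) sequentially" by (auto dest: order_tendstoD(2)[of _ 0 _ 1])
    then obtain N where N: "\<And>i. i \<ge> N \<Longrightarrow> s i < 1" by (auto simp: eventually_sequentially)
    have "(\<lambda>i. LINT \<omega>|M. (exp (- s (i + N) * X \<omega>) - 1) / s (i + N)) \<longlonglongrightarrow> (LINT \<omega>|M. - X \<omega>)"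
    proof (rule integral_dominated_convergence)
      show "integrable M (\<lambda>\<omega>. \<bar>X \<omega>\<bar> + exp (- X \<omega>) + 1)" using X int by simp
      have "filterlim s (at_right 0) sequentially"
        using s by (auto simp: filterlim_at dest: spec intro!: always_eventually) (metis less_irrefl)
      then have "filterlim (\<lambda>i. s (i + N)) (at_right 0) sequentially"
        by (rule filterlim_compose[OF _ filterlim_add_const_nat_at_top])
      from filterlim_compose[OF tendsto_exp_diff_quotient this]
      show "AE \<omega> in M. (\<lambda>i. (exp (- s (i + N) * X \<omega>) - 1) / s (i + N)) \<longlonglongrightarrow> - X \<omega>" by simp
      show "AE \<omega> in M. norm ((exp (- s (i + N) * X \<omega>) - 1) / s (i + N)) \<le> \<bar>X \<omega>\<bar> + exp (- X \<omega>) + 1" for i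
        using s(1) N[of "i + N"] unfolding real_norm_def by (intro AE_I2 bound) auto
    qed auto
    then show "(\<lambda>i. LINT \<omega>|M. (exp (- s i * X \<omega>) - 1) / s i) \<longlonglongrightarrow> (LINT \<omega>|M. - X \<omega>)"
      by (rule LIMSEQ_offset)
  qed
  then have lim: "((\<lambda>\<alpha>. LINT \<omega>|M. (exp (- \<alpha> * X \<omega>) - 1) / \<alpha>) \<longlongrightarrow> - (LINT \<omega>|M. X \<omega>)) (at_right 0)"
    by simp
  have "eventually (\<lambda>\<alpha>. (LINT \<omega>|M. (exp (- \<alpha> * X \<omega>) - 1) / \<alpha>) =
      ((LINT \<omega>|M. exp (- \<alpha> * X \<omega>)) - 1) / \<alpha>) (at_right 0)"
    using eventually_at_right_real[of 0 1, simplified]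
  proof eventually_elim
    case (elim \<alpha>)
    then have "integrable M (\<lambda>\<omega>. exp (- (\<alpha> * X \<omega>)))" using int_\<alpha>[of \<alpha>] by simp
    then show ?case by (simp add: prob_space)
  qed
  from tendsto_cong[THEN iffD1, OF this lim] show ?thesis .
qed

lemma right_deriv_0_eq:
  assumes "((\<lambda>\<alpha>. f \<alpha> / \<alpha>) \<longlongrightarrow> d) (at_right 0)" "f 0 = 0"
  shows "right_deriv_0 f = d"
proof -
  have "at (0::real) within {0..} = at_right 0" by (simp add: at_within_Ici_at_right)
  then have "(f has_vector_derivative d) (at 0 within {0..})"
    using assms unfolding has_real_derivative_iff_has_vector_derivative[symmetric] has_field_derivative_iff
    by simp
  then show ?thesis
    unfolding right_deriv_0_def by (intro vector_derivative_within) (auto simp: at_within_Ici_at_right)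
qed

section \<open>The maximum of a random walk with negative drift\<close>

text \<open>This is the maximum of the first \<open>n + 1\<close> partial sums \<open>0, \<omega> 0, \<omega> 0 + \<omega> 1, \<dots>\<close>
  (\<open>walk_max_increments\<close>). Peeling off the first step rather than the last one turns the decomposition of an
  i.i.d. sequence into its head and its tail into Lindley's recursion for the law of the maximum.\<close>

primrec walk_max :: "nat \<Rightarrow> (nat \<Rightarrow> real) \<Rightarrow> real" where
  "walk_max 0 \<omega> = 0"
| "walk_max (Suc n) \<omega> = max 0 (\<omega> 0 + walk_max n (\<lambda>i. \<omega> (Suc i)))"

lemma walk_max_nonneg: "0 \<le> walk_max n \<omega>"
  by (cases n) auto

lemma walk_max_Suc_ge: "walk_max n \<omega> \<le> walk_max (Suc n) \<omega>"
proof (induction n arbitrary: \<omega>)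
  case (Suc n)
  from Suc[of "\<lambda>i. \<omega> (Suc i)"] show ?case by simp
qed simp

lemma walk_max_increments: "walk_max n (\<lambda>i. x (Suc i) - x i) = Max (x ` {..n}) - x 0"
proof (induction n arbitrary: x)
  case (Suc n)
  have "x ` {..Suc n} = insert (x 0) ((\<lambda>i. x (Suc i)) ` {..n})"
    by (auto simp: image_iff) (metis atMost_iff le_Suc_eq not0_implies_Suc Suc_le_mono zero_le)
  with Suc[of "\<lambda>i. x (Suc i)"] show ?case by (simp add: max_def)
qed simp

lemma measurable_walk_max [measurable]:
  "walk_max n \<in> borel_measurable (\<Pi>\<^sub>M i\<in>(UNIV :: nat set). (borel :: real measure))"
proof (induction n)
  case (Suc n)
  have "(\<lambda>\<omega> i. \<omega> (Suc i)) \<in> (\<Pi>\<^sub>M i\<in>(UNIV :: nat set). (borel :: real measure)) \<rightarrow>\<^sub>M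
      (\<Pi>\<^sub>M i\<in>(UNIV :: nat set). (borel :: real measure))"
    by (intro measurable_PiM_single') (auto simp: space_PiM)
  from measurable_compose[OF this Suc]
  have [measurable]: "(\<lambda>\<omega>. walk_max n (\<lambda>i. \<omega> (Suc i))) \<in>
      borel_measurable (\<Pi>\<^sub>M i\<in>(UNIV :: nat set). (borel :: real measure))" .
  have "(\<lambda>\<omega>. max 0 (\<omega> 0 + walk_max n (\<lambda>i. \<omega> (Suc i)))) \<in>
      borel_measurable (\<Pi>\<^sub>M i\<in>(UNIV :: nat set). (borel :: real measure))"
    by measurable
  then show ?case by simp
qed simp

lemma (in prob_space) laplace_transform_tendsto_1:
  fixes X :: "'a \<Rightarrow> real"
  assumes [measurable]: "random_variable borel X" and nonneg: "\<And>\<omega>. 0 \<le> X \<omega>"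
  shows "((\<lambda>\<alpha>. expectation (\<lambda>\<omega>. exp (- \<alpha> * X \<omega>))) \<longlongrightarrow> 1) (at_right 0)"
  unfolding tendsto_at_iff_sequentially comp_def
proof safe
  fix s :: "nat \<Rightarrow> real" assume s: "\<forall>i. s i \<in> {0<..} - {0}" "s \<longlonglongrightarrow> 0"
  have "(\<lambda>i. expectation (\<lambda>\<omega>. exp (- s i * X \<omega>))) \<longlonglongrightarrow> expectation (\<lambda>\<omega>. exp (- 0 * X \<omega>))"
  proof (rule integral_dominated_convergence[where w="\<lambda>_. 1"])
    show "AE \<omega> in M. (\<lambda>i. exp (- s i * X \<omega>)) \<longlonglongrightarrow> exp (- 0 * X \<omega>)"
      using s(2) by (intro AE_I2 tendsto_intros)
    show "AE \<omega> in M. norm (exp (- s i * X \<omega>)) \<le> 1" for i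
      using s(1) nonneg by (intro AE_I2) (simp add: less_imp_le)
  qed auto
  then show "(\<lambda>i. expectation (\<lambda>\<omega>. exp (- s i * X \<omega>))) \<longlonglongrightarrow> 1" by (simp add: prob_space)
qed

text \<open>Here \<open>\<mu>\<close> is the law of one step and \<open>- d\<close> is its mean, given through the slope of the transform at
  \<open>0\<close>; in this form the mean is available for every skeleton of a Levy process from the exponent alone.\<close>

locale negative_drift_walk = real_distribution \<mu> for \<mu> :: "real measure" +
  fixes d :: real
  assumes drift_pos: "0 < d"
    and integrable_exp: "\<And>\<alpha>. 0 \<le> \<alpha> \<Longrightarrow> integrable \<mu> (\<lambda>x. exp (- \<alpha> * x))"
    and drift: "((\<lambda>\<alpha>. ((LINT x|\<mu>. exp (- \<alpha> * x)) - 1) / \<alpha>) \<longlongrightarrow> d) (at_right 0)"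
begin

sublocale W: sequence_space \<mu>
  by unfold_locales

definition step_transform :: "real \<Rightarrow> real" where
  "step_transform \<alpha> = (LINT x|\<mu>. exp (- \<alpha> * x))"

definition max_transform :: "nat \<Rightarrow> real \<Rightarrow> real" where
  "max_transform n \<alpha> = (LINT \<omega>|W.S. exp (- \<alpha> * walk_max n \<omega>))"

lemma measurable_walk_max' [measurable]: "walk_max n \<in> borel_measurable W.S"
proof -
  have "sets W.S = sets (\<Pi>\<^sub>M i\<in>(UNIV :: nat set). (borel :: real measure))"
    by (intro sets_PiM_cong) auto
  then show ?thesis
    using measurable_walk_max by (simp cong: measurable_cong_sets)
qed

sublocale pair: pair_prob_space \<mu> W.S
  by unfold_locales

lemma integrable_exp_max: "0 \<le> \<alpha> \<Longrightarrow> integrable W.S (\<lambda>\<omega>. exp (- \<alpha> * walk_max n \<omega>))"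
  by (intro W.integrable_const_bound[where B=1]) (auto simp: walk_max_nonneg)

lemma max_transform_Suc_le: "0 \<le> \<alpha> \<Longrightarrow> max_transform (Suc n) \<alpha> \<le> max_transform n \<alpha>"
  unfolding max_transform_def
  by (intro integral_mono integrable_exp_max) (auto intro!: mult_left_mono simp del: walk_max.simps simp: walk_max_Suc_ge)

lemma max_transform_nonneg: "0 \<le> max_transform n \<alpha>"
  unfolding max_transform_def by simp

lemma max_transform_le_1:
  assumes "0 \<le> \<alpha>" shows "max_transform n \<alpha> \<le> 1"
proof -
  have "max_transform n \<alpha> \<le> (LINT \<omega>|W.S. 1)"
    unfolding max_transform_def
    using assms by (intro integral_mono integrable_exp_max) (auto simp: walk_max_nonneg)
  then show ?thesis by (simp add: W.P.prob_space)
qed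

text \<open>The loss at the barrier \<open>0\<close> in Lindley's recursion: by how much a step plus the maximum of an
  independent walk falls short of \<open>0\<close>.\<close>

definition defect :: "nat \<Rightarrow> real \<times> (nat \<Rightarrow> real) \<Rightarrow> real" where
  "defect n = (\<lambda>(s, \<omega>). max 0 (- (s + walk_max n \<omega>)))"

lemma measurable_defect [measurable]: "defect n \<in> borel_measurable (\<mu> \<Otimes>\<^sub>M W.S)"
  unfolding defect_def by measurable

lemma defect_nonneg: "0 \<le> defect n z"
  by (auto simp: defect_def split: prod.splits)

lemma integrable_step: "0 \<le> \<alpha> \<Longrightarrow> integrable (\<mu> \<Otimes>\<^sub>M W.S) (\<lambda>z. exp (- \<alpha> * fst z))"
  by (rule pair.Fubini_integrable) (auto simp: integrable_exp[simplified] W.P.prob_space)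

lemma integrable_exp_defect:
  assumes "0 \<le> \<alpha>" shows "integrable (\<mu> \<Otimes>\<^sub>M W.S) (\<lambda>z. exp (\<alpha> * defect n z) - 1)"
proof -
  have "integrable (\<mu> \<Otimes>\<^sub>M W.S) (\<lambda>z. exp (\<alpha> * defect n z))"
  proof (rule Bochner_Integration.integrable_bound)
    show "integrable (\<mu> \<Otimes>\<^sub>M W.S) (\<lambda>z. 1 + exp (- \<alpha> * fst z))"
      using integrable_step[OF assms] by simp
    have "exp (\<alpha> * defect n z) \<le> 1 + exp (- \<alpha> * fst z)" for z
    proof (cases "defect n z = 0")
      case False
      then have "defect n z \<le> - fst z"
        using walk_max_nonneg[of n "snd z"] by (auto simp: defect_def split: prod.splits)
      from mult_left_mono[OF this assms] have "exp (\<alpha> * defect n z) \<le> exp (- \<alpha> * fst z)" by simp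
      then show ?thesis by linarith
    qed simp
    then show "AE z in \<mu> \<Otimes>\<^sub>M W.S. norm (exp (\<alpha> * defect n z)) \<le> norm (1 + exp (- \<alpha> * fst z))"
      by (intro AE_I2) (simp add: add_nonneg_nonneg)
  qed simp
  then show ?thesis by simp
qed

text \<open>Pointwise \<open>exp (- \<alpha> y) - exp (- \<alpha> max 0 y) = exp (\<alpha> max 0 (- y)) - 1\<close>; integrating this over an
  independent pair of a step and a maximum, \<open>y\<close> being their sum, gives the identity.\<close>

lemma lindley_identity:
  assumes "0 \<le> \<alpha>"
  shows "step_transform \<alpha> * max_transform n \<alpha> - max_transform (Suc n) \<alpha> =
    (LINT z|(\<mu> \<Otimes>\<^sub>M W.S). exp (\<alpha> * defect n z) - 1)"
proof -
  let ?f = "\<lambda>z. exp (- \<alpha> * fst z) * exp (- \<alpha> * walk_max n (snd z))"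
  have int: "integrable (\<mu> \<Otimes>\<^sub>M W.S) ?f"
    by (rule Bochner_Integration.integrable_bound[OF integrable_step[OF assms]])
      (use assms in \<open>auto simp: walk_max_nonneg mult_le_cancel_left\<close>)
  have "(LINT z|(\<mu> \<Otimes>\<^sub>M W.S). ?f z) = step_transform \<alpha> * max_transform n \<alpha>"
    using pair.integral_fst'[OF int] by (simp add: step_transform_def max_transform_def)
  moreover have "max_transform (Suc n) \<alpha> =
      (LINT z|(\<mu> \<Otimes>\<^sub>M W.S). exp (- \<alpha> * walk_max (Suc n) (case_nat (fst z) (snd z))))"
  proof -
    have "max_transform (Suc n) \<alpha> =
      (LINT \<omega>|(distr (\<mu> \<Otimes>\<^sub>M W.S) W.S (\<lambda>(s, \<omega>). case_nat s \<omega>)). exp (- \<alpha> * walk_max (Suc n) \<omega>))"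
      unfolding max_transform_def W.PiM_iter ..
    also have "\<dots> = (LINT z|(\<mu> \<Otimes>\<^sub>M W.S). exp (- \<alpha> * walk_max (Suc n) (case z of (s, \<omega>) \<Rightarrow> case_nat s \<omega>)))"
    proof (rule integral_distr)
      have "(\<lambda>\<omega>. exp (- \<alpha> * walk_max m \<omega>)) \<in> borel_measurable W.S" for m by measurable
      then show "(\<lambda>\<omega>. exp (- \<alpha> * walk_max (Suc n) \<omega>)) \<in> borel_measurable W.S" .
    qed measurable
    finally show ?thesis by (simp only: case_prod_beta)
  qed
  moreover have "(LINT z|(\<mu> \<Otimes>\<^sub>M W.S). exp (\<alpha> * defect n z) - 1) =
      (LINT z|(\<mu> \<Otimes>\<^sub>M W.S). ?f z) - (LINT z|(\<mu> \<Otimes>\<^sub>M W.S). exp (- \<alpha> * max 0 (fst z + walk_max n (snd z))))"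
  proof -
    have "integrable (\<mu> \<Otimes>\<^sub>M W.S) (\<lambda>z. exp (- \<alpha> * max 0 (fst z + walk_max n (snd z))))"
      using assms by (intro pair.P.integrable_const_bound[where B=1]) auto
    moreover have "?f z - exp (- \<alpha> * max 0 (fst z + walk_max n (snd z))) = exp (\<alpha> * defect n z) - 1" for z
      by (cases z) (auto simp: defect_def max_def exp_add[symmetric] algebra_simps)
    ultimately show ?thesis
      using int by (simp only: Bochner_Integration.integral_diff[symmetric])
  qed
  ultimately show ?thesis by simp
qed

text \<open>By convexity \<open>(exp (\<beta> V) - 1) / \<beta>\<close> increases in \<open>\<beta>\<close>, where \<open>V\<close> is the defect. So its mean at \<open>\<alpha>\<close> is at
  least the limit of its mean as \<open>\<beta> \<rightarrow> 0\<close>. The latter is bounded below by \<open>d\<close> because the transform of the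
  maximum decreases with the number of steps.\<close>

lemma lindley_lower:
  assumes "0 < \<alpha>"
  shows "\<alpha> * d \<le> step_transform \<alpha> * max_transform n \<alpha> - max_transform (Suc n) \<alpha>"
proof (rule tendsto_upperbound)
  show "((\<lambda>\<beta>. \<alpha> * (((step_transform \<beta> - 1) / \<beta>) * max_transform n \<beta>)) \<longlongrightarrow> \<alpha> * d) (at_right 0)"
    using tendsto_mult[OF tendsto_const tendsto_mult[OF drift W.laplace_transform_tendsto_1[where X="walk_max n"]]]
    by (simp add: step_transform_def max_transform_def walk_max_nonneg)
  show "\<forall>\<^sub>F \<beta> in at_right 0. \<alpha> * (((step_transform \<beta> - 1) / \<beta>) * max_transform n \<beta>) \<le>
      step_transform \<alpha> * max_transform n \<alpha> - max_transform (Suc n) \<alpha>"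
    using eventually_at_right_real[OF assms]
  proof eventually_elim
    case (elim \<beta>)
    then have b: "0 < \<beta>" "\<beta> \<le> \<alpha>" by auto
    have "(\<alpha> / \<beta>) * (LINT z|(\<mu> \<Otimes>\<^sub>M W.S). exp (\<beta> * defect n z) - 1) =
        (LINT z|(\<mu> \<Otimes>\<^sub>M W.S). (\<alpha> / \<beta>) * (exp (\<beta> * defect n z) - 1))"
      by simp
    also have "\<dots> \<le> (LINT z|(\<mu> \<Otimes>\<^sub>M W.S). exp (\<alpha> * defect n z) - 1)"
    proof (intro integral_mono integrable_mult_right integrable_exp_defect)
      fix z
      have "exp ((\<beta> / \<alpha>) * (\<alpha> * defect n z)) - 1 \<le> (\<beta> / \<alpha>) * (exp (\<alpha> * defect n z) - 1)"
        using b assms by (intro exp_minus_one_bounds) auto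
      then have "exp (\<beta> * defect n z) - 1 \<le> (\<beta> / \<alpha>) * (exp (\<alpha> * defect n z) - 1)"
        using assms by simp
      then have "(\<alpha> / \<beta>) * (exp (\<beta> * defect n z) - 1) \<le> (\<alpha> / \<beta>) * ((\<beta> / \<alpha>) * (exp (\<alpha> * defect n z) - 1))"
        using b assms by (intro mult_left_mono) auto
      then show "(\<alpha> / \<beta>) * (exp (\<beta> * defect n z) - 1) \<le> exp (\<alpha> * defect n z) - 1"
        using b assms by simp
    qed (use b in auto)
    finally have *: "(\<alpha> / \<beta>) * (step_transform \<beta> * max_transform n \<beta> - max_transform (Suc n) \<beta>) \<le>
        step_transform \<alpha> * max_transform n \<alpha> - max_transform (Suc n) \<alpha>"
      using b assms by (simp add: lindley_identity)
    have "(\<alpha> / \<beta>) * (step_transform \<beta> * max_transform n \<beta> - max_transform n \<beta>) \<le>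
        (\<alpha> / \<beta>) * (step_transform \<beta> * max_transform n \<beta> - max_transform (Suc n) \<beta>)"
      using b assms by (intro mult_left_mono diff_left_mono max_transform_Suc_le) auto
    with * show ?case by (simp add: algebra_simps diff_divide_distrib)
  qed
qed simp

text \<open>Where the defect \<open>V\<close> is at most \<open>\<epsilon>\<close>, the convex function \<open>exp (\<alpha> V) - 1\<close> is almost linear in \<open>V\<close>
  and hence controlled by \<open>(exp (\<beta> V) - 1) / \<beta>\<close>. Where it exceeds \<open>\<epsilon>\<close>, the step itself is at most \<open>- V\<close>,
  which a Chernoff bound with parameter \<open>\<theta>\<close> makes unlikely.\<close>

lemma lindley_upper:
  assumes "0 < \<beta>" "0 < \<alpha>" "0 < \<epsilon>" "\<alpha> \<le> \<theta>"
  shows "step_transform \<alpha> * max_transform n \<alpha> - max_transform (Suc n) \<alpha> \<le>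
    \<alpha> * exp (\<alpha> * \<epsilon>) / \<beta> * (step_transform \<beta> * max_transform n \<beta> - max_transform (Suc n) \<beta>) +
    exp (- (\<theta> - \<alpha>) * \<epsilon>) * step_transform \<theta>"
proof -
  have pt: "exp (\<alpha> * defect n z) - 1 \<le>
      \<alpha> * exp (\<alpha> * \<epsilon>) / \<beta> * (exp (\<beta> * defect n z) - 1) + exp (- (\<theta> - \<alpha>) * \<epsilon>) * exp (- \<theta> * fst z)" for z
  proof -
    define v where "v = defect n z"
    have v: "0 \<le> v" by (simp add: v_def defect_nonneg)
    have first: "0 \<le> \<alpha> * exp (\<alpha> * \<epsilon>) / \<beta> * (exp (\<beta> * v) - 1)"
      using assms v by simp
    show ?thesis
    proof (cases "v \<le> \<epsilon>")
      case True
      \<comment> \<open>This is \<open>exp x - 1 \<le> x exp x\<close> at \<open>x = \<alpha> v\<close>.\<close>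
      have "1 - \<alpha> * v \<le> exp (- (\<alpha> * v))" using exp_ge_add_one_self[of "- (\<alpha> * v)"] by simp
      then have "(1 - \<alpha> * v) * exp (\<alpha> * v) \<le> exp (- (\<alpha> * v)) * exp (\<alpha> * v)"
        by (intro mult_right_mono) auto
      also have "\<dots> = 1" by (simp add: exp_add[symmetric])
      finally have "exp (\<alpha> * v) - 1 \<le> \<alpha> * v * exp (\<alpha> * v)" by (simp add: algebra_simps)
      also have "\<dots> \<le> \<alpha> * v * exp (\<alpha> * \<epsilon>)"
        using assms v True by (intro mult_left_mono) auto
      also have "\<dots> = \<alpha> * exp (\<alpha> * \<epsilon>) / \<beta> * (\<beta> * v)"
        using assms by simp
      also have "\<dots> \<le> \<alpha> * exp (\<alpha> * \<epsilon>) / \<beta> * (exp (\<beta> * v) - 1)"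
      proof (rule mult_left_mono)
        show "\<beta> * v \<le> exp (\<beta> * v) - 1" using exp_ge_add_one_self[of "\<beta> * v"] by linarith
      qed (use assms in auto)
      finally show ?thesis
        unfolding v_def[symmetric] by (simp add: add_increasing2)
    next
      case False
      then have "v \<le> - fst z"
        using walk_max_nonneg[of n "snd z"] assms by (auto simp: v_def defect_def split: prod.splits)
      then have "\<theta> * v \<le> - \<theta> * fst z"
        using assms mult_left_mono[of v "- fst z" \<theta>] by simp
      moreover have "(\<theta> - \<alpha>) * \<epsilon> \<le> (\<theta> - \<alpha>) * v"
        using False assms by (intro mult_left_mono) auto
      ultimately have "exp (\<alpha> * v) \<le> exp (- (\<theta> - \<alpha>) * \<epsilon> + - \<theta> * fst z)"
        by (simp add: algebra_simps)
      then have "exp (\<alpha> * v) - 1 \<le> exp (- (\<theta> - \<alpha>) * \<epsilon>) * exp (- \<theta> * fst z)"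
        unfolding exp_add by linarith
      with first show ?thesis unfolding v_def[symmetric] by linarith
    qed
  qed
  have eq: "(LINT z|(\<mu> \<Otimes>\<^sub>M W.S). exp (- \<theta> * fst z)) = step_transform \<theta>"
    using pair.integral_fst'[OF integrable_step[of \<theta>]] assms by (simp add: step_transform_def W.P.prob_space)
  have "(LINT z|(\<mu> \<Otimes>\<^sub>M W.S). exp (\<alpha> * defect n z) - 1) \<le>
      (LINT z|(\<mu> \<Otimes>\<^sub>M W.S). \<alpha> * exp (\<alpha> * \<epsilon>) / \<beta> * (exp (\<beta> * defect n z) - 1) +
        exp (- (\<theta> - \<alpha>) * \<epsilon>) * exp (- \<theta> * fst z))"
    using assms
    by (intro integral_mono Bochner_Integration.integrable_add integrable_mult_right integrable_exp_defect
        integrable_step pt) auto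
  also have "\<dots> = \<alpha> * exp (\<alpha> * \<epsilon>) / \<beta> * (LINT z|(\<mu> \<Otimes>\<^sub>M W.S). exp (\<beta> * defect n z) - 1) +
      exp (- (\<theta> - \<alpha>) * \<epsilon>) * (LINT z|(\<mu> \<Otimes>\<^sub>M W.S). exp (- \<theta> * fst z))"
    using assms
    by (subst Bochner_Integration.integral_add, intro integrable_mult_right integrable_exp_defect, simp,
        intro integrable_mult_right integrable_step, simp_all)
  finally show ?thesis
    using assms by (simp only: eq lindley_identity less_imp_le)
qed

text \<open>The limit is the mean of \<open>exp (- \<alpha> M)\<close> with \<open>M\<close> the supremum of the walk and \<open>exp (- \<infinity>) = 0\<close>, so it is
  meaningful before the supremum is known to be finite.\<close>

definition sup_transform :: "real \<Rightarrow> real" where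
  "sup_transform \<alpha> = lim (\<lambda>n. max_transform n \<alpha>)"

lemma max_transform_tendsto:
  assumes "0 \<le> \<alpha>" shows "(\<lambda>n. max_transform n \<alpha>) \<longlonglongrightarrow> sup_transform \<alpha>"
proof -
  have "decseq (\<lambda>n. max_transform n \<alpha>)"
    using max_transform_Suc_le[OF assms] by (intro decseq_SucI)
  then obtain l where "(\<lambda>n. max_transform n \<alpha>) \<longlonglongrightarrow> l"
    using decseq_convergent[of _ 0] max_transform_nonneg by metis
  then show ?thesis unfolding sup_transform_def by (simp add: limI)
qed

text \<open>Letting the number of steps tend to infinity merges the two transforms of Lindley's identity into
  one; letting \<open>\<beta> \<rightarrow> 0\<close> afterwards replaces the auxiliary parameter by the drift.\<close>

lemma sup_transform_bounds:
  assumes "0 < \<alpha>"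
  shows "\<alpha> * d \<le> sup_transform \<alpha> * (step_transform \<alpha> - 1)"
    and "0 < \<epsilon> \<Longrightarrow> \<alpha> \<le> \<theta> \<Longrightarrow> sup_transform \<alpha> * (step_transform \<alpha> - 1) \<le>
      \<alpha> * exp (\<alpha> * \<epsilon>) * d + exp (- (\<theta> - \<alpha>) * \<epsilon>) * step_transform \<theta>"
proof -
  have lim: "(\<lambda>n. step_transform \<gamma> * max_transform n \<gamma> - max_transform (Suc n) \<gamma>)
      \<longlonglongrightarrow> sup_transform \<gamma> * (step_transform \<gamma> - 1)" if "0 < \<gamma>" for \<gamma>
  proof -
    have "(\<lambda>n. step_transform \<gamma> * max_transform n \<gamma> - max_transform (Suc n) \<gamma>)
      \<longlonglongrightarrow> step_transform \<gamma> * sup_transform \<gamma> - sup_transform \<gamma>"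
      using that by (intro tendsto_intros max_transform_tendsto LIMSEQ_Suc) auto
    then show ?thesis by (simp add: algebra_simps)
  qed
  have lower: "\<gamma> * d \<le> sup_transform \<gamma> * (step_transform \<gamma> - 1)" if "0 < \<gamma>" for \<gamma>
    using that by (intro LIMSEQ_le_const[OF lim]) (auto intro: lindley_lower)
  show "\<alpha> * d \<le> sup_transform \<alpha> * (step_transform \<alpha> - 1)"
    by (rule lower) fact
  have le_step: "sup_transform \<gamma> * (step_transform \<gamma> - 1) \<le> step_transform \<gamma> - 1" if "0 < \<gamma>" for \<gamma>
  proof -
    have "0 \<le> sup_transform \<gamma>" "sup_transform \<gamma> \<le> 1"
      using that max_transform_tendsto[of \<gamma>] max_transform_nonneg max_transform_le_1[of \<gamma>]
      by (auto intro: LIMSEQ_le_const LIMSEQ_le_const2)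
    moreover have "0 < sup_transform \<gamma> * (step_transform \<gamma> - 1)"
      using lower[OF that] mult_pos_pos[OF that drift_pos] by linarith
    ultimately show ?thesis
      by (intro mult_left_le_one_le) (auto simp: zero_less_mult_iff)
  qed
  assume e: "0 < \<epsilon>" "\<alpha> \<le> \<theta>"
  show "sup_transform \<alpha> * (step_transform \<alpha> - 1) \<le>
      \<alpha> * exp (\<alpha> * \<epsilon>) * d + exp (- (\<theta> - \<alpha>) * \<epsilon>) * step_transform \<theta>"
  proof (rule tendsto_lowerbound)
    show "((\<lambda>\<beta>. \<alpha> * exp (\<alpha> * \<epsilon>) * ((step_transform \<beta> - 1) / \<beta>) + exp (- (\<theta> - \<alpha>) * \<epsilon>) * step_transform \<theta>)
        \<longlongrightarrow> \<alpha> * exp (\<alpha> * \<epsilon>) * d + exp (- (\<theta> - \<alpha>) * \<epsilon>) * step_transform \<theta>) (at_right 0)"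
      unfolding step_transform_def by (intro tendsto_intros drift)
    show "\<forall>\<^sub>F \<beta> in at_right 0. sup_transform \<alpha> * (step_transform \<alpha> - 1) \<le>
        \<alpha> * exp (\<alpha> * \<epsilon>) * ((step_transform \<beta> - 1) / \<beta>) + exp (- (\<theta> - \<alpha>) * \<epsilon>) * step_transform \<theta>"
      using eventually_at_right_less[of 0]
    proof eventually_elim
      case (elim \<beta>)
      have "sup_transform \<alpha> * (step_transform \<alpha> - 1) \<le> \<alpha> * exp (\<alpha> * \<epsilon>) / \<beta> *
          (sup_transform \<beta> * (step_transform \<beta> - 1)) + exp (- (\<theta> - \<alpha>) * \<epsilon>) * step_transform \<theta>"
        using elim assms e
        by (intro LIMSEQ_le[OF lim tendsto_add[OF tendsto_mult[OF tendsto_const lim] tendsto_const]]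
            exI[of _ 0] allI impI lindley_upper)
      also have "\<alpha> * exp (\<alpha> * \<epsilon>) / \<beta> * (sup_transform \<beta> * (step_transform \<beta> - 1)) \<le>
          \<alpha> * exp (\<alpha> * \<epsilon>) / \<beta> * (step_transform \<beta> - 1)"
        using elim assms by (intro mult_left_mono le_step) auto
      finally show ?case by (simp only: times_divide_eq_left times_divide_eq_right)
    qed
  qed simp
qed

end

section \<open>The supremum of a Levy process without negative jumps\<close>

lemma levy_process_fst:
  fixes Y :: "real \<Rightarrow> 'a \<Rightarrow> 'b::euclidean_space" and Z :: "real \<Rightarrow> 'a \<Rightarrow> 'c::euclidean_space"
  assumes "prob_space M" and "\<And>t. sets (F t) \<subseteq> sets M" "\<And>t. space (F t) = space M"
    and levy: "levy_process M F (\<lambda>t \<omega>. (Y t \<omega>, Z t \<omega>))"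
  shows "levy_process M F Y"
  unfolding levy_process_def
proof (intro conjI allI impI)
  interpret prob_space M by fact
  have fst_borel: "(fst :: 'b \<times> 'c \<Rightarrow> 'b) \<in> borel \<rightarrow>\<^sub>M borel"
    by (simp add: borel_prod[symmetric])
  have meas: "(\<lambda>\<omega>. (Y t \<omega>, Z t \<omega>)) \<in> borel_measurable (F (ennreal t))" if "0 \<le> t" for t
    using levy that by (auto simp: levy_process_def)
  have measM: "(\<lambda>\<omega>. (Y t \<omega>, Z t \<omega>)) \<in> borel_measurable M" if "0 \<le> t" for t
    using meas[OF that] assms(2,3) by (auto simp: measurable_def)
  show "Y t \<in> borel_measurable (F (ennreal t))" if "0 \<le> t" for t
    using measurable_compose[OF meas[OF that] fst_borel] by simp
  show "AE \<omega> in M. Y 0 \<omega> = 0"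
    using levy by (auto simp: levy_process_def zero_prod_def)
  have "AE \<omega> in M. cadlag (\<lambda>t. (Y t \<omega>, Z t \<omega>))"
    using levy by (auto simp: levy_process_def)
  then show "AE \<omega> in M. cadlag (\<lambda>t. Y t \<omega>)"
  proof eventually_elim
    case (elim \<omega>)
    show ?case
      unfolding cadlag_def
    proof (intro conjI allI impI)
      fix t :: real assume "0 \<le> t"
      with elim have "continuous (at_right t) (\<lambda>t. (Y t \<omega>, Z t \<omega>))" by (auto simp: cadlag_def)
      from continuous_fst[OF this] show "continuous (at_right t) (\<lambda>t. Y t \<omega>)" by simp
    next
      fix t :: real assume "0 < t"
      with elim obtain l where "((\<lambda>t. (Y t \<omega>, Z t \<omega>)) \<longlongrightarrow> l) (at_left t)" by (auto simp: cadlag_def)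
      from tendsto_fst[OF this] show "\<exists>l. ((\<lambda>t. Y t \<omega>) \<longlongrightarrow> l) (at_left t)" by auto
    qed
  qed
  fix s t :: real assume st: "0 \<le> s \<and> s \<le> t"
  have ind: "indep_set (sets (F (ennreal s)))
      {(\<lambda>\<omega>. (Y t \<omega>, Z t \<omega>) - (Y s \<omega>, Z s \<omega>)) -` A \<inter> space M |A. A \<in> sets borel}"
    and dist: "distr M borel (\<lambda>\<omega>. (Y t \<omega>, Z t \<omega>) - (Y s \<omega>, Z s \<omega>)) =
      distr M borel (\<lambda>\<omega>. (Y (t - s) \<omega>, Z (t - s) \<omega>))"
    using levy st unfolding levy_process_def by blast+
  show "indep_set (sets (F (ennreal s))) {(\<lambda>\<omega>. Y t \<omega> - Y s \<omega>) -` A \<inter> space M |A. A \<in> sets borel}"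
    unfolding indep_set_def
  proof (rule indep_sets_mono_sets[OF ind[unfolded indep_set_def]])
    fix b :: bool
    have "(\<lambda>\<omega>. Y t \<omega> - Y s \<omega>) -` A \<inter> space M \<in>
        {(\<lambda>\<omega>. (Y t \<omega>, Z t \<omega>) - (Y s \<omega>, Z s \<omega>)) -` A \<inter> space M |A. A \<in> sets borel}"
      if A: "A \<in> sets borel" for A
    proof -
      have "fst -` A \<in> sets (borel :: ('b \<times> 'c) measure)"
        using measurable_sets[OF fst_borel A] by simp
      moreover have "(\<lambda>\<omega>. Y t \<omega> - Y s \<omega>) -` A \<inter> space M =
          (\<lambda>\<omega>. (Y t \<omega>, Z t \<omega>) - (Y s \<omega>, Z s \<omega>)) -` (fst -` A) \<inter> space M"
        by auto
      ultimately show ?thesis by blast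
    qed
    then show "(case b of True \<Rightarrow> sets (F (ennreal s)) |
          False \<Rightarrow> {(\<lambda>\<omega>. Y t \<omega> - Y s \<omega>) -` A \<inter> space M |A. A \<in> sets borel})
        \<subseteq> (case b of True \<Rightarrow> sets (F (ennreal s)) |
          False \<Rightarrow> {(\<lambda>\<omega>. (Y t \<omega>, Z t \<omega>) - (Y s \<omega>, Z s \<omega>)) -` A \<inter> space M |A. A \<in> sets borel})"
      by (cases b) auto
  qed
  have "distr (distr M borel (\<lambda>\<omega>. (Y t \<omega>, Z t \<omega>) - (Y s \<omega>, Z s \<omega>))) borel fst =
      distr (distr M borel (\<lambda>\<omega>. (Y (t - s) \<omega>, Z (t - s) \<omega>))) borel fst"
    by (simp only: dist)
  then show "distr M borel (\<lambda>\<omega>. Y t \<omega> - Y s \<omega>) = distr M borel (Y (t - s))"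
    using fst_borel measM[of s] measM[of t] measM[of "t - s"] st
    by (simp add: distr_distr comp_def borel_measurable_diff del: diff_Pair)
qed

context standard_filtration
begin

lemma levy_process_measurable:
  assumes "levy_process M F X" "0 \<le> t"
  shows "X t \<in> borel_measurable M"
proof -
  have "X t \<in> borel_measurable (F (ennreal t))" using assms by (auto simp: levy_process_def)
  then show ?thesis using sets_F_subset space_F by (auto simp: measurable_def)
qed

text \<open>Independence of a finite family of increments follows by induction on its last index: the earlier
  increments are measurable at the time where the last one starts.\<close>

lemma levy_increments_iid:
  fixes X :: "real \<Rightarrow> 'a \<Rightarrow> real"
  assumes levy: "levy_process M F X" and "0 < h"
  defines "\<xi> \<equiv> \<lambda>i \<omega>. X (real (Suc i) * h) \<omega> - X (real i * h) \<omega>"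
  shows "indep_vars (\<lambda>_. borel) \<xi> UNIV" and "distr M borel (\<xi> i) = distr M borel (X h)"
proof -
  have X: "X (real k * h) \<in> borel_measurable (F (ennreal (real k * h)))" for k
    using levy \<open>0 < h\<close> by (auto simp: levy_process_def)
  have XF: "X (real k * h) \<in> borel_measurable (F (ennreal (real l * h)))" if "k \<le> l" for k l
  proof -
    have "ennreal (real k * h) \<le> ennreal (real l * h)"
      using that \<open>0 < h\<close> by (intro ennreal_leI mult_right_mono) auto
    from sets_F_mono[OF this] X[of k] show ?thesis
      by (auto simp: measurable_def space_F)
  qed
  have \<xi>F: "\<xi> i \<in> borel_measurable (F (ennreal (real l * h)))" if "i < l" for i l
    unfolding \<xi>_def using that by (intro borel_measurable_diff XF) auto
  have \<xi>M: "\<xi> i \<in> borel_measurable M" for i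
    unfolding \<xi>_def using \<open>0 < h\<close> levy_process_measurable[OF levy] by (intro borel_measurable_diff) auto
  have ind: "indep_set (sets (F (ennreal (real i * h)))) {\<xi> i -` A \<inter> space M |A. A \<in> sets borel}" for i
    using levy \<open>0 < h\<close> unfolding levy_process_def \<xi>_def by (auto intro!: mult_right_mono)
  have dist: "distr M borel (\<xi> i) = distr M borel (X (real (Suc i) * h - real i * h))" for i
    using levy \<open>0 < h\<close> unfolding levy_process_def \<xi>_def by (auto intro!: mult_right_mono)
  show "distr M borel (\<xi> i) = distr M borel (X h)"
    using dist[of i] by (simp add: algebra_simps)
  show "indep_vars (\<lambda>_. borel) \<xi> UNIV"
    unfolding indep_vars_def2
  proof (intro conjI ballI \<xi>M indep_setsI)
    show "{\<xi> i -` A \<inter> space M |A. A \<in> sets borel} \<subseteq> events" for i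
      using \<xi>M[of i] by (auto simp: measurable_def)
    fix A and J :: "nat set"
    assume "J \<noteq> {}" "finite J" and A: "\<forall>j\<in>J. A j \<in> {\<xi> j -` B \<inter> space M |B. B \<in> sets borel}"
    have "prob (space M \<inter> (\<Inter>j\<in>J. A j)) = (\<Prod>j\<in>J. prob (A j))"
      using \<open>finite J\<close> A
    proof (induction J rule: finite_linorder_max_induct)
      case (insert b J)
      have "A j \<in> sets (F (ennreal (real b * h)))" if "j \<in> J" for j
      proof -
        have "A j \<in> {\<xi> j -` B \<inter> space M |B. B \<in> sets borel}" using insert.prems that by blast
        then obtain B where "B \<in> sets borel" "A j = \<xi> j -` B \<inter> space M" by blast
        with \<xi>F[of j b] insert.hyps that show ?thesis
          by (auto simp: measurable_def space_F)
      qed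
      moreover have "space M \<in> sets (F (ennreal (real b * h)))"
        using sets.top[of "F (ennreal (real b * h))"] by (simp only: space_F)
      ultimately have "space M \<inter> (\<Inter>j\<in>J. A j) \<in> sets (F (ennreal (real b * h)))"
        using insert.hyps by (cases "J = {}") (auto intro!: sets.Int sets.finite_INT)
      moreover have "A b \<in> {\<xi> b -` B \<inter> space M |B. B \<in> sets borel}"
        using insert.prems by auto
      ultimately have "prob ((space M \<inter> (\<Inter>j\<in>J. A j)) \<inter> A b) = prob (space M \<inter> (\<Inter>j\<in>J. A j)) * prob (A b)"
        by (rule indep_setD[OF ind])
      moreover have "(space M \<inter> (\<Inter>j\<in>J. A j)) \<inter> A b = space M \<inter> (\<Inter>j\<in>insert b J. A j)" by auto
      moreover have "b \<notin> J" using insert.hyps by auto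
      ultimately show ?case
        using insert by (simp add: mult.commute)
    qed (simp add: prob_space)
    moreover have "space M \<inter> (\<Inter>j\<in>J. A j) = (\<Inter>j\<in>J. A j)"
      using A \<open>J \<noteq> {}\<close> by fastforce
    ultimately show "prob (\<Inter>j\<in>J. A j) = (\<Prod>j\<in>J. prob (A j))" by simp
  qed
qed

text \<open>The transform at time \<open>1\<close> is the \<open>N\<close>-th power of the transform at time \<open>1 / N\<close>. Working in the
  extended nonnegative reals yields integrability at time \<open>1 / N\<close> along with the value.\<close>

lemma levy_laplace_transform_fraction:
  fixes X :: "real \<Rightarrow> 'a \<Rightarrow> real"
  assumes levy: "levy_process M F X" and "0 < N"
    and int: "integrable M (\<lambda>\<omega>. exp (- \<alpha> * X 1 \<omega>))"
    and exponent: "expectation (\<lambda>\<omega>. exp (- \<alpha> * X 1 \<omega>)) = exp p"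
  shows "integrable M (\<lambda>\<omega>. exp (- \<alpha> * X (1 / real N) \<omega>))"
    and "expectation (\<lambda>\<omega>. exp (- \<alpha> * X (1 / real N) \<omega>)) = exp (p / N)"
proof -
  define h where "h = 1 / real N"
  have h: "0 < h" "real N * h = 1" using \<open>0 < N\<close> by (auto simp: h_def)
  define \<xi> where "\<xi> = (\<lambda>i \<omega>. X (real (Suc i) * h) \<omega> - X (real i * h) \<omega>)"
  have iid: "indep_vars (\<lambda>_. borel) \<xi> UNIV" "distr M borel (\<xi> i) = distr M borel (X h)" for i
    using levy_increments_iid[OF levy h(1)] unfolding \<xi>_def by blast+
  have [measurable]: "X t \<in> borel_measurable M" if "0 \<le> t" for t
    by (rule levy_process_measurable[OF levy that])
  have [measurable]: "X h \<in> borel_measurable M" using h by simp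
  have \<xi>M [measurable]: "\<xi> i \<in> borel_measurable M" for i
    using iid(1) by (auto simp: indep_vars_def2)
  define x where "x = (\<integral>\<^sup>+\<omega>. ennreal (exp (- \<alpha> * X h \<omega>)) \<partial>M)"
  have each: "(\<integral>\<^sup>+\<omega>. ennreal (exp (- \<alpha> * \<xi> i \<omega>)) \<partial>M) = x" for i
  proof -
    have "(\<integral>\<^sup>+\<omega>. ennreal (exp (- \<alpha> * \<xi> i \<omega>)) \<partial>M) = (\<integral>\<^sup>+y. ennreal (exp (- \<alpha> * y)) \<partial>distr M borel (\<xi> i))"
      by (subst nn_integral_distr) auto
    also have "\<dots> = (\<integral>\<^sup>+y. ennreal (exp (- \<alpha> * y)) \<partial>distr M borel (X h))"
      by (simp only: iid(2))
    also have "\<dots> = x"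
      unfolding x_def by (subst nn_integral_distr) auto
    finally show ?thesis .
  qed
  have "(\<Prod>i<N. exp (- \<alpha> * \<xi> i \<omega>)) = exp (- \<alpha> * (X 1 \<omega> - X 0 \<omega>))" for \<omega>
  proof -
    have "(\<Sum>i<N. \<xi> i \<omega>) = X 1 \<omega> - X 0 \<omega>"
      unfolding \<xi>_def using sum_lessThan_telescope[of "\<lambda>i. X (real i * h) \<omega>" N] h(2) by simp
    then show ?thesis by (simp add: exp_sum[symmetric] sum_negf sum_distrib_left[symmetric])
  qed
  then have "(\<integral>\<^sup>+\<omega>. ennreal (exp (- \<alpha> * X 1 \<omega>)) \<partial>M) = (\<integral>\<^sup>+\<omega>. (\<Prod>i<N. ennreal (exp (- \<alpha> * \<xi> i \<omega>))) \<partial>M)"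
    using levy by (intro nn_integral_cong_AE) (auto simp: prod_ennreal levy_process_def elim!: eventually_mono)
  also have "\<dots> = (\<Prod>i<N. \<integral>\<^sup>+\<omega>. ennreal (exp (- \<alpha> * \<xi> i \<omega>)) \<partial>M)"
  proof (rule indep_vars_nn_integral)
    show "indep_vars (\<lambda>_. borel) (\<lambda>i \<omega>. ennreal (exp (- \<alpha> * \<xi> i \<omega>))) {..<N}"
      by (rule indep_vars_compose2[OF indep_vars_subset[OF iid(1)]]) auto
  qed auto
  also have "\<dots> = x ^ N"
    by (simp only: each prod_constant card_lessThan)
  finally have pow: "ennreal (exp p) = x ^ N"
    using nn_integral_eq_integral[OF int] exponent by simp
  have "x \<noteq> \<infinity>"
  proof
    assume "x = \<infinity>"
    then have "x ^ N = \<infinity>" using \<open>0 < N\<close> by (simp add: power_eq_top_ennreal)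
    with pow show False by simp
  qed
  then obtain r where r: "0 \<le> r" "x = ennreal r" by (cases x) auto
  with pow have "r ^ N = exp p"
    by (simp add: ennreal_power ennreal_inj)
  also have "\<dots> = exp (p / N) ^ N"
    using \<open>0 < N\<close> by (simp add: exp_of_nat_mult[symmetric])
  finally have r_eq: "r = exp (p / N)"
    using r(1) \<open>0 < N\<close> by (intro power_eq_imp_eq_base[of r N "exp (p / N)"]) auto
  show "integrable M (\<lambda>\<omega>. exp (- \<alpha> * X (1 / real N) \<omega>))"
    using r x_def by (intro integrableI_nn_integral_finite[of _ _ r]) (auto simp: h_def[symmetric])
  show "expectation (\<lambda>\<omega>. exp (- \<alpha> * X (1 / real N) \<omega>)) = exp (p / N)"
    using r x_def r_eq by (intro integral_eq_nn_integral[THEN trans]) (auto simp: h_def[symmetric])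
qed

end

lemma (in complete_measure) measurable_AE_eq:
  assumes g [measurable]: "g \<in> M \<rightarrow>\<^sub>M N" and eq: "AE x in M. f x = g x" and f: "f \<in> space M \<rightarrow> space N"
  shows "f \<in> M \<rightarrow>\<^sub>M N"
proof (rule measurableI)
  fix A assume A: "A \<in> sets N"
  obtain Z where Z: "Z \<in> null_sets M" "{x \<in> space M. f x \<noteq> g x} \<subseteq> Z"
    using eq by (auto simp: eventually_ae_filter)
  have "f -` A \<inter> space M \<inter> Z \<in> sets M"
    using Z(1) by (intro complete[of _ Z]) auto
  then have "(g -` A \<inter> space M - Z) \<union> (f -` A \<inter> space M \<inter> Z) \<in> sets M"
    using A Z(1) by (intro sets.Un sets.Diff measurable_sets[OF g]) auto
  also have "(g -` A \<inter> space M - Z) \<union> (f -` A \<inter> space M \<inter> Z) = f -` A \<inter> space M"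
    using Z(2) by auto
  finally show "f -` A \<inter> space M \<in> sets M" .
qed (use f in auto)

text \<open>A right-continuous function takes almost its infimum at points slightly to the right of any
  near-minimizer, and such points exist on every fine mesh.\<close>

lemma INF_mesh_tendsto:
  fixes f :: "real \<Rightarrow> real"
  assumes nonneg: "\<And>s. 0 \<le> s \<Longrightarrow> 0 \<le> f s"
    and cont: "\<And>s. 0 \<le> s \<Longrightarrow> continuous (at_right s) f"
  shows "(\<lambda>n. INF j. f (real j / real (Suc n))) \<longlonglongrightarrow> (INF s\<in>{0..}. f s)"
proof (rule order_tendstoI)
  have bdd: "bdd_below (f ` {0..})" by (rule bdd_belowI2[of _ 0]) (simp add: nonneg)
  have bdd': "bdd_below (range (\<lambda>j. f (real j / real (Suc n))))" for n
    by (rule bdd_belowI2[of _ 0]) (simp add: nonneg)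
  have ge: "(INF s\<in>{0..}. f s) \<le> (INF j. f (real j / real (Suc n)))" for n
  proof (rule cINF_greatest)
    show "(INF s\<in>{0..}. f s) \<le> f (real j / real (Suc n))" for j
      by (rule cINF_lower[OF bdd, of "real j / real (Suc n)"]) simp
  qed simp
  show "\<forall>\<^sub>F n in sequentially. a < (INF j. f (real j / real (Suc n)))" if "a < (INF s\<in>{0..}. f s)" for a
    by (intro always_eventually allI less_le_trans[OF that ge])
  show "\<forall>\<^sub>F n in sequentially. (INF j. f (real j / real (Suc n))) < a" if a: "(INF s\<in>{0..}. f s) < a" for a
  proof -
    obtain s where s: "0 \<le> s" "f s < a"
      using a by (subst (asm) cINF_less_iff[OF _ bdd]) auto
    \<comment> \<open>The first mesh point strictly to the right of \<open>s\<close>.\<close>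
    define j where "j n = nat (\<lfloor>s * real (Suc n)\<rfloor> + 1)" for n
    have fl: "real (j n) = of_int \<lfloor>s * real (Suc n)\<rfloor> + 1" for n
      using s by (simp add: j_def)
    have j1: "s < real (j n) / real (Suc n)" for n
    proof -
      have "s * real (Suc n) < real (j n)"
        unfolding fl by (rule real_of_int_floor_add_one_gt)
      then show ?thesis by (simp add: pos_less_divide_eq del: of_nat_Suc)
    qed
    have j2: "real (j n) / real (Suc n) \<le> s + 1 / real (Suc n)" for n
    proof -
      have "real (j n) \<le> s * real (Suc n) + 1"
        unfolding fl by (intro add_right_mono of_int_floor_le)
      then have "real (j n) / real (Suc n) \<le> (s * real (Suc n) + 1) / real (Suc n)"
        by (intro divide_right_mono) auto
      then show ?thesis by (simp add: add_divide_distrib del: of_nat_Suc)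
    qed
    have "(\<lambda>n. real (j n) / real (Suc n)) \<longlonglongrightarrow> s"
    proof (rule tendsto_sandwich[OF _ _ tendsto_const])
      show "(\<lambda>n. s + 1 / real (Suc n)) \<longlonglongrightarrow> s"
        using tendsto_add[OF tendsto_const[of s] lim_1_over_n[THEN LIMSEQ_Suc]] by simp
      show "\<forall>\<^sub>F n in sequentially. s \<le> real (j n) / real (Suc n)"
        by (intro always_eventually allI less_imp_le[OF j1])
      show "\<forall>\<^sub>F n in sequentially. real (j n) / real (Suc n) \<le> s + 1 / real (Suc n)"
        by (intro always_eventually allI j2)
    qed
    then have "filterlim (\<lambda>n. real (j n) / real (Suc n)) (at_right s) sequentially"
      by (rule tendsto_imp_filterlim_at_right) (intro always_eventually allI j1)
    moreover have "(f \<longlongrightarrow> f s) (at_right s)"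
      using cont[OF s(1)] by (simp add: continuous_within)
    ultimately have "(\<lambda>n. f (real (j n) / real (Suc n))) \<longlonglongrightarrow> f s"
      by (rule filterlim_compose[rotated])
    from order_tendstoD(2)[OF this s(2)] show ?thesis
    proof eventually_elim
      case (elim n)
      from cINF_lower[OF bdd', of "j n" n] elim show ?case by simp
    qed
  qed
qed

lemma INF_exp_eq_exp_SUP:
  fixes f :: "'b \<Rightarrow> real"
  assumes "0 < \<alpha>" "A \<noteq> {}" "bdd_above (f ` A)"
  shows "(INF s\<in>A. exp (- \<alpha> * f s)) = exp (- \<alpha> * (SUP s\<in>A. f s))"
proof -
  have "exp (- \<alpha> * Sup (f ` A)) = (INF y\<in>f ` A. exp (- \<alpha> * y))"
    using assms by (intro continuous_at_Sup_antimono) (auto simp: monotone_def intro!: continuous_intros)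
  then show ?thesis by (simp add: image_image)
qed

text \<open>With \<open>INF_exp_eq_exp_SUP\<close> this says that the infimum of \<open>exp (- \<alpha> f)\<close> is the right substitute for
  \<open>exp (- \<alpha> SUP f)\<close> when the supremum may be infinite.\<close>

lemma INF_exp_eq_0:
  fixes f :: "'b \<Rightarrow> real"
  assumes "0 < \<alpha>" "A \<noteq> {}" "\<not> bdd_above (f ` A)"
  shows "(INF s\<in>A. exp (- \<alpha> * f s)) = 0"
proof (rule antisym)
  have bdd: "bdd_below ((\<lambda>s. exp (- \<alpha> * f s)) ` A)" by (auto intro!: bdd_belowI[of _ 0])
  show "(INF s\<in>A. exp (- \<alpha> * f s)) \<le> 0"
  proof (rule field_le_epsilon)
    fix e :: real assume "0 < e"
    obtain s where s: "s \<in> A" "- ln e / \<alpha> < f s"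
      using assms(3) by (auto simp: bdd_above_def not_le)
    then have "- ln e < \<alpha> * f s" using assms(1) by (simp add: field_simps)
    then have "exp (- \<alpha> * f s) \<le> exp (ln e)" by simp
    with \<open>0 < e\<close> have "exp (- \<alpha> * f s) \<le> 0 + e" by simp
    with cINF_lower[OF bdd s(1)] show "(INF s\<in>A. exp (- \<alpha> * f s)) \<le> 0 + e" by linarith
  qed
  show "0 \<le> (INF s\<in>A. exp (- \<alpha> * f s))"
    using assms(2) by (intro cINF_greatest) auto
qed

lemma exp_Max_tendsto_INF:
  fixes f :: "nat \<Rightarrow> real"
  assumes "0 \<le> \<alpha>"
  shows "(\<lambda>n. exp (- \<alpha> * Max (f ` {..n}))) \<longlonglongrightarrow> (INF j. exp (- \<alpha> * f j))"
proof -
  have bdd: "bdd_below (range (\<lambda>n. exp (- \<alpha> * Max (f ` {..n}))))" "bdd_below (range (\<lambda>j. exp (- \<alpha> * f j)))"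
    by (auto intro: bdd_belowI2[of _ 0])
  have "decseq (\<lambda>n. exp (- \<alpha> * Max (f ` {..n})))"
    using assms by (auto simp: decseq_def intro!: mult_left_mono Max_mono)
  from LIMSEQ_decseq_INF[OF bdd(1) this]
  have "(\<lambda>n. exp (- \<alpha> * Max (f ` {..n}))) \<longlonglongrightarrow> (INF n. exp (- \<alpha> * Max (f ` {..n})))" .
  also have "(INF n. exp (- \<alpha> * Max (f ` {..n}))) = (INF j. exp (- \<alpha> * f j))"
  proof (rule antisym)
    show "(INF n. exp (- \<alpha> * Max (f ` {..n}))) \<le> (INF j. exp (- \<alpha> * f j))"
    proof (rule cINF_mono[OF _ bdd(1)])
      fix j :: nat
      have "exp (- \<alpha> * Max (f ` {..j})) \<le> exp (- \<alpha> * f j)"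
        using assms by (auto intro!: mult_left_mono)
      then show "\<exists>n\<in>UNIV. exp (- \<alpha> * Max (f ` {..n})) \<le> exp (- \<alpha> * f j)" by blast
    qed simp
    show "(INF j. exp (- \<alpha> * f j)) \<le> (INF n. exp (- \<alpha> * Max (f ` {..n})))"
    proof (rule cINF_mono[OF _ bdd(2)])
      fix n :: nat
      have "Max (f ` {..n}) \<in> f ` {..n}" by (intro Max_in) auto
      then obtain j where "Max (f ` {..n}) = f j" by blast
      then show "\<exists>j\<in>UNIV. exp (- \<alpha> * f j) \<le> exp (- \<alpha> * Max (f ` {..n}))" by force
    qed simp
  qed
  finally show ?thesis .
qed

context standard_filtration
begin

text \<open>The absence of negative jumps enters through the existence of the exponent on the whole half-line
  and through \<open>growth\<close>, by which the lower tail of \<open>X 1\<close> is at most Gaussian.\<close>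

context
  fixes X :: "real \<Rightarrow> 'a \<Rightarrow> real" and \<phi> :: "real \<Rightarrow> real" and m C :: real
  assumes levy: "levy_process M F X"
    and int: "\<And>\<alpha>. 0 \<le> \<alpha> \<Longrightarrow> integrable M (\<lambda>\<omega>. exp (- \<alpha> * X 1 \<omega>))"
    and exponent: "\<And>\<alpha>. 0 \<le> \<alpha> \<Longrightarrow> expectation (\<lambda>\<omega>. exp (- \<alpha> * X 1 \<omega>)) = exp (\<phi> \<alpha>)"
    and slope_pos: "0 < m" and slope: "((\<lambda>\<alpha>. \<phi> \<alpha> / \<alpha>) \<longlongrightarrow> m) (at_right 0)"
    and growth: "\<And>\<alpha>. 1 \<le> \<alpha> \<Longrightarrow> \<phi> \<alpha> \<le> C * \<alpha>\<^sup>2"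
begin

lemma mesh_walk:
  assumes "0 < N"
  shows "negative_drift_walk (distr M borel (X (1 / real N))) (m / real N)"
proof -
  define h where "h = 1 / real N"
  have h: "0 < h" using assms by (simp add: h_def)
  have Xh [measurable]: "X h \<in> borel_measurable M" using levy_process_measurable[OF levy, of h] h by simp
  interpret D: real_distribution "distr M borel (X h)" by (rule real_distribution_distr) simp
  have transform: "integrable M (\<lambda>\<omega>. exp (- \<alpha> * X h \<omega>))"
      "expectation (\<lambda>\<omega>. exp (- \<alpha> * X h \<omega>)) = exp (\<phi> \<alpha> * h)" if "0 \<le> \<alpha>" for \<alpha>
    using levy_laplace_transform_fraction[OF levy assms int[OF that] exponent[OF that]] by (simp_all add: h_def)
  have "negative_drift_walk (distr M borel (X h)) (m * h)"
  proof
    show "0 < m * h" using slope_pos h by simp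
    show "integrable (distr M borel (X h)) (\<lambda>x. exp (- \<alpha> * x))" if "0 \<le> \<alpha>" for \<alpha>
      using transform(1)[OF that] by (subst integrable_distr_eq) auto
    have "exp (\<phi> 0) = 1" using exponent[of 0] by (simp add: prob_space)
    then have "\<phi> 0 = 0" by simp
    have at0: "at (0::real) within {0..} = at_right 0" by (simp add: at_within_Ici_at_right)
    have "(\<phi> has_real_derivative m) (at 0 within {0..})"
      using slope \<open>\<phi> 0 = 0\<close> unfolding has_field_derivative_iff at0 by simp
    then have "((\<lambda>\<beta>. exp (\<phi> \<beta> * h)) has_real_derivative m * h) (at 0 within {0..})"
      by (auto intro!: derivative_eq_intros simp: \<open>\<phi> 0 = 0\<close>)
    then have "((\<lambda>\<beta>. (exp (\<phi> \<beta> * h) - 1) / \<beta>) \<longlongrightarrow> m * h) (at_right 0)"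
      using \<open>\<phi> 0 = 0\<close> unfolding has_field_derivative_iff at0 by simp
    moreover have "\<forall>\<^sub>F \<beta> in at_right 0. (exp (\<phi> \<beta> * h) - 1) / \<beta> =
        ((LINT x|distr M borel (X h). exp (- \<beta> * x)) - 1) / \<beta>"
      using eventually_at_right_less[of 0]
    proof eventually_elim
      case (elim \<beta>)
      have "(LINT x|distr M borel (X h). exp (- \<beta> * x)) = expectation (\<lambda>\<omega>. exp (- \<beta> * X h \<omega>))"
        by (subst integral_distr) auto
      with transform(2)[of \<beta>] elim show ?case by simp
    qed
    ultimately show "((\<lambda>\<beta>. ((LINT x|distr M borel (X h). exp (- \<beta> * x)) - 1) / \<beta>) \<longlongrightarrow> m * h) (at_right 0)"
      by (rule Lim_transform_eventually)
  qed
  then show ?thesis by (simp add: h_def)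
qed

lemma mesh_transform_measurable [measurable]:
  "(\<lambda>\<omega>. INF j. exp (- \<alpha> * X (real j / real N) \<omega>)) \<in> borel_measurable M"
  by (intro borel_measurable_cINF levy_process_measurable[OF levy] borel_measurable_exp[THEN measurable_compose_rev]
      borel_measurable_times) (auto intro: bdd_belowI2[of _ 0] levy_process_measurable[OF levy])

lemma mesh_transform_bounds:
  assumes "0 < N" "0 < \<alpha>"
  defines "B \<equiv> expectation (\<lambda>\<omega>. INF j. exp (- \<alpha> * X (real j / real N) \<omega>))"
  shows "0 \<le> B" "B \<le> 1"
    and "\<alpha> * (m / N) \<le> B * (exp (\<phi> \<alpha> / N) - 1)"
    and "0 < \<epsilon> \<Longrightarrow> \<alpha> \<le> \<theta> \<Longrightarrow> B * (exp (\<phi> \<alpha> / N) - 1) \<le>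
      \<alpha> * exp (\<alpha> * \<epsilon>) * (m / N) + exp (- (\<theta> - \<alpha>) * \<epsilon>) * exp (\<phi> \<theta> / N)"
proof -
  define h where "h = 1 / real N"
  have h: "0 < h" using assms by (simp add: h_def)
  have Xt: "X t \<in> borel_measurable M" if "0 \<le> t" for t using levy_process_measurable[OF levy that] .
  have Xh [measurable]: "X h \<in> borel_measurable M" using Xt h by simp
  have [measurable]: "X (real j * h) \<in> borel_measurable M" for j using Xt h by simp
  interpret R: negative_drift_walk "distr M borel (X h)" "m / real N"
    using mesh_walk[OF assms(1)] by (simp add: h_def)
  define \<xi> where "\<xi> = (\<lambda>i \<omega>. X (real (Suc i) * h) \<omega> - X (real i * h) \<omega>)"
  have iid: "indep_vars (\<lambda>_. borel) \<xi> UNIV" "distr M borel (\<xi> i) = distr M borel (X h)" for i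
    using levy_increments_iid[OF levy h] unfolding \<xi>_def by blast+
  have \<xi>M [measurable]: "\<xi> i \<in> borel_measurable M" for i
    using iid(1) by (auto simp: indep_vars_def2)
  have law: "distr M (\<Pi>\<^sub>M i\<in>UNIV. borel) (\<lambda>\<omega> i. \<xi> i \<omega>) = R.W.S"
    using iid(1) unfolding indep_vars_iff_distr_eq_PiM'[OF UNIV_not_empty \<xi>M] by (simp add: iid(2) restrict_UNIV)
  have \<xi>_joint [measurable]: "(\<lambda>\<omega> i. \<xi> i \<omega>) \<in> M \<rightarrow>\<^sub>M (\<Pi>\<^sub>M i\<in>UNIV. borel)"
    by (intro measurable_PiM_single') (auto simp: space_PiM)
  have X0: "AE \<omega> in M. X 0 \<omega> = 0" using levy by (simp add: levy_process_def)
  have step: "R.step_transform \<gamma> = exp (\<phi> \<gamma> / N)" if "0 \<le> \<gamma>" for \<gamma>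
  proof -
    have "R.step_transform \<gamma> = expectation (\<lambda>\<omega>. exp (- \<gamma> * X h \<omega>))"
      unfolding R.step_transform_def by (subst integral_distr) auto
    then show ?thesis
      using levy_laplace_transform_fraction(2)[OF levy assms(1) int[OF that] exponent[OF that]] by (simp add: h_def)
  qed
  have "R.max_transform n \<alpha> = expectation (\<lambda>\<omega>. exp (- \<alpha> * Max ((\<lambda>j. X (real j * h) \<omega>) ` {..n})))" for n
  proof -
    have "R.max_transform n \<alpha> = expectation (\<lambda>\<omega>. exp (- \<alpha> * walk_max n (\<lambda>i. \<xi> i \<omega>)))"
      unfolding R.max_transform_def law[symmetric] by (subst integral_distr) auto
    also have "\<dots> = expectation (\<lambda>\<omega>. exp (- \<alpha> * Max ((\<lambda>j. X (real j * h) \<omega>) ` {..n})))"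
    proof (rule integral_cong_AE)
      show "AE \<omega> in M. exp (- \<alpha> * walk_max n (\<lambda>i. \<xi> i \<omega>)) =
          exp (- \<alpha> * Max ((\<lambda>j. X (real j * h) \<omega>) ` {..n}))"
        using X0
      proof eventually_elim
        case (elim \<omega>)
        then show ?case
          using walk_max_increments[of n "\<lambda>j. X (real j * h) \<omega>"] by (simp add: \<xi>_def)
      qed
    qed (use measurable_compose[OF \<xi>_joint measurable_walk_max] in measurable)
    finally show ?thesis .
  qed
  moreover have "(\<lambda>n. expectation (\<lambda>\<omega>. exp (- \<alpha> * Max ((\<lambda>j. X (real j * h) \<omega>) ` {..n})))) \<longlonglongrightarrow> B"
    unfolding B_def
  proof (rule integral_dominated_convergence[where w="\<lambda>_. 1"])
    show "AE \<omega> in M. (\<lambda>n. exp (- \<alpha> * Max ((\<lambda>j. X (real j * h) \<omega>) ` {..n})))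
        \<longlonglongrightarrow> (INF j. exp (- \<alpha> * X (real j / real N) \<omega>))"
      using exp_Max_tendsto_INF[of \<alpha> "\<lambda>j. X (real j * h) \<omega>" for \<omega>] assms(2) by (simp add: h_def)
    show "AE \<omega> in M. norm (exp (- \<alpha> * Max ((\<lambda>j. X (real j * h) \<omega>) ` {..n}))) \<le> 1" for n
      using X0
    proof eventually_elim
      case (elim \<omega>)
      have "X (real 0 * h) \<omega> \<le> Max ((\<lambda>j. X (real j * h) \<omega>) ` {..n})"
        by (rule Max_ge) (auto intro!: image_eqI[where x=0])
      with elim assms(2) show ?case by simp
    qed
  qed (use mesh_transform_measurable[of \<alpha> N] in auto)
  ultimately have lim: "(\<lambda>n. R.max_transform n \<alpha>) \<longlonglongrightarrow> B" by simp
  then have B: "R.sup_transform \<alpha> = B"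
    unfolding R.sup_transform_def by (rule limI)
  show "0 \<le> B" "B \<le> 1"
    using lim R.max_transform_nonneg R.max_transform_le_1[of \<alpha>] assms(2)
    by (auto intro: LIMSEQ_le_const LIMSEQ_le_const2)
  show "\<alpha> * (m / N) \<le> B * (exp (\<phi> \<alpha> / N) - 1)"
    using R.sup_transform_bounds(1)[OF assms(2)] assms(2) by (simp add: B step)
  show "B * (exp (\<phi> \<alpha> / N) - 1) \<le>
      \<alpha> * exp (\<alpha> * \<epsilon>) * (m / N) + exp (- (\<theta> - \<alpha>) * \<epsilon>) * exp (\<phi> \<theta> / N)" if "0 < \<epsilon>" "\<alpha> \<le> \<theta>"
    using R.sup_transform_bounds(2)[OF assms(2) that] assms(2) that by (simp add: B step)
qed

text \<open>The two-sided bounds for the walk of mesh \<open>1 / N\<close> are multiplied by \<open>N\<close>. The error is balanced by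
  \<open>\<theta> = \<surd>N\<close>, for which the Chernoff factor \<open>exp (\<phi> \<theta> / N)\<close> stays bounded by quadratic growth, and
  \<open>\<epsilon> = N\<^sup>-\<^sup>1\<^sup>/\<^sup>4\<close>, which tends to \<open>0\<close> while \<open>\<theta> \<epsilon>\<close> tends to infinity faster than \<open>ln N\<close>.\<close>

lemma mesh_transform_tendsto:
  assumes "0 < \<alpha>"
  shows "0 < \<phi> \<alpha>"
    and "(\<lambda>n. expectation (\<lambda>\<omega>. INF j. exp (- \<alpha> * X (real j / real (Suc n)) \<omega>))) \<longlonglongrightarrow> \<alpha> * m / \<phi> \<alpha>"
proof -
  define B where "B n = expectation (\<lambda>\<omega>. INF j. exp (- \<alpha> * X (real j / real (Suc n)) \<omega>))" for n
  define c where "c n = real (Suc n) * (exp (\<phi> \<alpha> / real (Suc n)) - 1)" for n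
  note bounds = mesh_transform_bounds[OF zero_less_Suc assms, folded B_def]
  have c: "c \<longlonglongrightarrow> \<phi> \<alpha>" unfolding c_def by real_asymp
  have lower: "\<alpha> * m \<le> B n * c n" for n
  proof -
    have "real (Suc n) * (\<alpha> * (m / real (Suc n))) \<le> real (Suc n) * (B n * (exp (\<phi> \<alpha> / real (Suc n)) - 1))"
      by (intro mult_left_mono bounds) auto
    then show ?thesis by (simp add: c_def mult.left_commute)
  qed
  have upper: "B n * c n \<le> \<alpha> * exp (\<alpha> * real (Suc n) powr (-1/4)) * m +
      real (Suc n) * exp (- (sqrt (real (Suc n)) - \<alpha>) * real (Suc n) powr (-1/4)) * exp C"
    if "\<alpha> \<le> sqrt (real (Suc n))" for n
  proof -
    let ?N = "real (Suc n)"
    have "\<phi> (sqrt ?N) / ?N \<le> C * (sqrt ?N)\<^sup>2 / ?N"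
      by (intro divide_right_mono growth) auto
    then have g: "exp (\<phi> (sqrt ?N) / ?N) \<le> exp C" by simp
    have "?N * (B n * (exp (\<phi> \<alpha> / ?N) - 1)) \<le> ?N * (\<alpha> * exp (\<alpha> * ?N powr (-1/4)) * (m / ?N) +
        exp (- (sqrt ?N - \<alpha>) * ?N powr (-1/4)) * exp (\<phi> (sqrt ?N) / ?N))"
      by (intro mult_left_mono bounds that) auto
    also have "\<dots> \<le> ?N * (\<alpha> * exp (\<alpha> * ?N powr (-1/4)) * (m / ?N) +
        exp (- (sqrt ?N - \<alpha>) * ?N powr (-1/4)) * exp C)"
      by (intro mult_left_mono add_left_mono g) auto
    finally show ?thesis by (simp add: c_def distrib_left mult.assoc mult.left_commute[of "B n"] del: of_nat_Suc)
  qed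
  have Bc: "(\<lambda>n. B n * c n) \<longlonglongrightarrow> \<alpha> * m"
  proof (rule tendsto_sandwich[OF _ _ tendsto_const])
    have "(\<lambda>n. exp (\<alpha> * real (Suc n) powr (-1/4))) \<longlonglongrightarrow> 1" by real_asymp
    moreover have "(\<lambda>n. real (Suc n) * exp (- (sqrt (real (Suc n)) - \<alpha>) * real (Suc n) powr (-1/4))) \<longlonglongrightarrow> 0"
      by real_asymp
    ultimately have "(\<lambda>n. \<alpha> * exp (\<alpha> * real (Suc n) powr (-1/4)) * m +
      real (Suc n) * exp (- (sqrt (real (Suc n)) - \<alpha>) * real (Suc n) powr (-1/4)) * exp C)
        \<longlonglongrightarrow> \<alpha> * 1 * m + 0 * exp C"
      by (intro tendsto_intros)
    then show "(\<lambda>n. \<alpha> * exp (\<alpha> * real (Suc n) powr (-1/4)) * m +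
      real (Suc n) * exp (- (sqrt (real (Suc n)) - \<alpha>) * real (Suc n) powr (-1/4)) * exp C) \<longlonglongrightarrow> \<alpha> * m"
      by simp
    have "\<forall>\<^sub>F n in sequentially. \<alpha> \<le> sqrt (real (Suc n))" by real_asymp
    then show "\<forall>\<^sub>F n in sequentially. B n * c n \<le> \<alpha> * exp (\<alpha> * real (Suc n) powr (-1/4)) * m +
      real (Suc n) * exp (- (sqrt (real (Suc n)) - \<alpha>) * real (Suc n) powr (-1/4)) * exp C"
      by eventually_elim (rule upper)
    show "\<forall>\<^sub>F n in sequentially. \<alpha> * m \<le> B n * c n"
      by (intro always_eventually allI lower)
  qed
  have c_ge: "\<alpha> * m \<le> c n" for n
  proof -
    have "0 < B n * c n" using lower[of n] mult_pos_pos[OF assms slope_pos] by linarith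
    then have "B n * c n \<le> c n"
      using bounds(1,2)[of n] by (intro mult_left_le_one_le) (auto simp: zero_less_mult_iff)
    with lower[of n] show ?thesis by linarith
  qed
  have "\<alpha> * m \<le> \<phi> \<alpha>"
    by (rule LIMSEQ_le_const[OF c]) (use c_ge in blast)
  with mult_pos_pos[OF assms slope_pos] show pos: "0 < \<phi> \<alpha>" by linarith
  have "(\<lambda>n. B n * c n / c n) \<longlonglongrightarrow> \<alpha> * m / \<phi> \<alpha>"
    using pos by (intro tendsto_divide Bc c) auto
  moreover have "B n * c n / c n = B n" for n
  proof -
    have "0 < c n" using c_ge[of n] mult_pos_pos[OF assms slope_pos] by linarith
    then show ?thesis by simp
  qed
  ultimately show "B \<longlonglongrightarrow> \<alpha> * m / \<phi> \<alpha>" by (simp only:)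
qed

text \<open>The infimum over an uncountable set of times is measurable because it agrees almost surely with the
  limit over meshes and the measure is complete.\<close>

lemma infimum_transform:
  assumes "0 < \<alpha>"
  shows "(\<lambda>\<omega>. INF s\<in>{0..}. exp (- \<alpha> * X s \<omega>)) \<in> borel_measurable M"
    and "expectation (\<lambda>\<omega>. INF s\<in>{0..}. exp (- \<alpha> * X s \<omega>)) = \<alpha> * m / \<phi> \<alpha>"
    and "AE \<omega> in M. (INF s\<in>{0..}. exp (- \<alpha> * X s \<omega>)) \<le> 1"
proof -
  define Z where "Z = (\<lambda>\<omega>. INF s\<in>{0..}. exp (- \<alpha> * X s \<omega>))"
  define G where "G = (\<lambda>n \<omega>. INF j. exp (- \<alpha> * X (real j / real (Suc n)) \<omega>))"
  have [measurable]: "G n \<in> borel_measurable M" for n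
    unfolding G_def by measurable
  have "AE \<omega> in M. cadlag (\<lambda>t. X t \<omega>)" and X0: "AE \<omega> in M. X 0 \<omega> = 0"
    using levy by (auto simp: levy_process_def)
  then have lim: "AE \<omega> in M. (\<lambda>n. G n \<omega>) \<longlonglongrightarrow> Z \<omega>"
  proof eventually_elim
    case (elim \<omega>)
    show ?case
      unfolding G_def Z_def
    proof (rule INF_mesh_tendsto)
      show "continuous (at_right s) (\<lambda>s. exp (- \<alpha> * X s \<omega>))" if "0 \<le> s" for s
        using elim that by (auto simp: cadlag_def intro!: continuous_intros)
    qed simp
  qed
  have "AE \<omega> in M. Z \<omega> = lim (\<lambda>n. G n \<omega>)"
    using lim by eventually_elim (simp add: limI)
  then show Z_meas [measurable]: "Z \<in> borel_measurable M"
    by (rule measurable_AE_eq[rotated]) auto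
  have bound: "AE \<omega> in M. 0 \<le> G n \<omega> \<and> G n \<omega> \<le> 1" for n
    using X0
  proof eventually_elim
    case (elim \<omega>)
    have "(INF j. exp (- \<alpha> * X (real j / real (Suc n)) \<omega>)) \<le> exp (- \<alpha> * X (real 0 / real (Suc n)) \<omega>)"
      by (rule cINF_lower) (auto intro: bdd_belowI2[of _ 0])
    with elim have "G n \<omega> \<le> 1" by (simp add: G_def)
    moreover have "0 \<le> G n \<omega>" unfolding G_def by (rule cINF_greatest) auto
    ultimately show ?case by simp
  qed
  have "(\<lambda>n. expectation (G n)) \<longlonglongrightarrow> expectation Z"
  proof (rule integral_dominated_convergence[where w="\<lambda>_. 1"])
    show "AE \<omega> in M. norm (G n \<omega>) \<le> 1" for n
      using bound[of n] by eventually_elim simp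
  qed (use lim in auto)
  moreover have "(\<lambda>n. expectation (G n)) \<longlonglongrightarrow> \<alpha> * m / \<phi> \<alpha>"
    unfolding G_def by (rule mesh_transform_tendsto) fact
  ultimately show "expectation Z = \<alpha> * m / \<phi> \<alpha>"
    by (rule LIMSEQ_unique)
  show "AE \<omega> in M. Z \<omega> \<le> 1"
    using X0
  proof eventually_elim
    case (elim \<omega>)
    have "Z \<omega> \<le> exp (- \<alpha> * X 0 \<omega>)"
      unfolding Z_def by (rule cINF_lower) (auto intro: bdd_belowI2[of _ 0])
    with elim show ?case by simp
  qed
qed

text \<open>The infimum of \<open>exp (- \<alpha> X)\<close> vanishes exactly on the unbounded paths, for every \<open>\<alpha> > 0\<close>. Its mean
  tends to \<open>1\<close> as \<open>\<alpha> \<rightarrow> 0\<close>, and it is at most \<open>1\<close>, so the unbounded paths have probability \<open>0\<close>.\<close>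

lemma paths_bounded_above: "AE \<omega> in M. bdd_above ((\<lambda>s. X s \<omega>) ` {0..})"
proof -
  define Z where "Z = (\<lambda>\<alpha> \<omega>. INF s\<in>{0..}. exp (- \<alpha> * X s \<omega>))"
  have Z [measurable]: "Z \<alpha> \<in> borel_measurable M" if "0 < \<alpha>" for \<alpha>
    using infimum_transform(1)[OF that] by (simp add: Z_def)
  have [measurable]: "Z 1 \<in> borel_measurable M" by (rule Z) simp
  have bdd_iff: "Z \<alpha> \<omega> = 0 \<longleftrightarrow> \<not> bdd_above ((\<lambda>s. X s \<omega>) ` {0..})" if "0 < \<alpha>" for \<alpha> \<omega>
    using INF_exp_eq_exp_SUP[OF that, of "{0..}" "\<lambda>s. X s \<omega>"] INF_exp_eq_0[OF that, of "{0..}" "\<lambda>s. X s \<omega>"]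
    by (auto simp: Z_def)
  let ?p = "prob {\<omega>\<in>space M. Z 1 \<omega> \<noteq> 0}"
  have le: "\<alpha> * m / \<phi> \<alpha> \<le> ?p" if \<alpha>: "0 < \<alpha>" for \<alpha>
  proof -
    have "\<alpha> * m / \<phi> \<alpha> = expectation (Z \<alpha>)"
      using infimum_transform(2)[OF \<alpha>] by (simp add: Z_def)
    also have "\<dots> \<le> expectation (indicator {\<omega>\<in>space M. Z 1 \<omega> \<noteq> 0})"
    proof (rule integral_mono_AE)
      have nonneg: "0 \<le> Z \<alpha> \<omega>" for \<omega> unfolding Z_def by (rule cINF_greatest) auto
      show "AE \<omega> in M. Z \<alpha> \<omega> \<le> indicator {\<omega>\<in>space M. Z 1 \<omega> \<noteq> 0} \<omega>"
        using infimum_transform(3)[OF \<alpha>] AE_space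
      proof eventually_elim
        case (elim \<omega>)
        then show ?case
          using bdd_iff[OF \<alpha>, of \<omega>] bdd_iff[of 1 \<omega>] by (auto simp: Z_def[symmetric] indicator_def) (simp add: Z_def)
      qed
      show "integrable M (Z \<alpha>)"
        using infimum_transform(3)[OF \<alpha>] Z[OF \<alpha>] nonneg
        by (intro integrable_const_bound[where B=1]) (auto simp: Z_def)
      show "integrable M (indicator {\<omega>\<in>space M. Z 1 \<omega> \<noteq> 0} :: 'a \<Rightarrow> real)"
        by (rule integrable_real_indicator) (auto simp: emeasure_eq_measure)
    qed
    also have "\<dots> = ?p" by simp
    finally show ?thesis .
  qed
  have "((\<lambda>\<alpha>. m / (\<phi> \<alpha> / \<alpha>)) \<longlongrightarrow> m / m) (at_right 0)"
    using slope_pos by (intro tendsto_intros slope) auto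
  moreover have "\<forall>\<^sub>F \<alpha> in at_right 0. m / (\<phi> \<alpha> / \<alpha>) \<le> ?p"
    using eventually_at_right_less[of 0] by eventually_elim (use le in \<open>simp add: mult.commute\<close>)
  ultimately have "m / m \<le> ?p"
    by (rule tendsto_upperbound) simp
  then have "?p = 1" using slope_pos prob_le_1 by (intro antisym) auto
  then have "AE \<omega> in M. \<omega> \<in> {\<omega>\<in>space M. Z 1 \<omega> \<noteq> 0}"
    by (subst (asm) prob_eq_1) auto
  then show ?thesis
    by eventually_elim (use bdd_iff[of 1] in auto)
qed

lemma levy_supremum:
  shows "(\<lambda>\<omega>. SUP s\<in>{0..}. X s \<omega>) \<in> borel_measurable M"
    and "AE \<omega> in M. 0 \<le> (SUP s\<in>{0..}. X s \<omega>)"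
    and "0 < \<alpha> \<Longrightarrow> expectation (\<lambda>\<omega>. exp (- \<alpha> * (SUP s\<in>{0..}. X s \<omega>))) = \<alpha> * m / \<phi> \<alpha>"
proof -
  have eq: "AE \<omega> in M. exp (- \<alpha> * (SUP s\<in>{0..}. X s \<omega>)) = (INF s\<in>{0..}. exp (- \<alpha> * X s \<omega>))" if "0 < \<alpha>" for \<alpha>
    using paths_bounded_above by eventually_elim (rule INF_exp_eq_exp_SUP[OF that _, symmetric], auto)
  have ln_eq: "AE \<omega> in M. (SUP s\<in>{0..}. X s \<omega>) = - ln (INF s\<in>{0..}. exp (- 1 * X s \<omega>))"
    using eq[OF zero_less_one]
  proof eventually_elim
    case (elim \<omega>)
    have "ln (INF s\<in>{0..}. exp (- 1 * X s \<omega>)) = - 1 * (SUP s\<in>{0..}. X s \<omega>)"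
      unfolding elim[symmetric] by (rule ln_exp)
    then show ?case by linarith
  qed
  show meas [measurable]: "(\<lambda>\<omega>. SUP s\<in>{0..}. X s \<omega>) \<in> borel_measurable M"
  proof (rule measurable_AE_eq[OF _ ln_eq])
    have [measurable]: "(\<lambda>\<omega>. INF s\<in>{0..}. exp (- 1 * X s \<omega>)) \<in> borel_measurable M"
      by (rule infimum_transform(1)) simp
    show "(\<lambda>\<omega>. - ln (INF s\<in>{0..}. exp (- 1 * X s \<omega>))) \<in> borel_measurable M"
      by measurable
  qed simp
  have "AE \<omega> in M. X 0 \<omega> = 0" using levy by (auto simp: levy_process_def)
  with paths_bounded_above show "AE \<omega> in M. 0 \<le> (SUP s\<in>{0..}. X s \<omega>)"
  proof eventually_elim
    case (elim \<omega>)
    have "X 0 \<omega> \<le> (SUP s\<in>{0..}. X s \<omega>)" using elim by (intro cSUP_upper) auto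
    with elim show ?case by simp
  qed
  show "expectation (\<lambda>\<omega>. exp (- \<alpha> * (SUP s\<in>{0..}. X s \<omega>))) = \<alpha> * m / \<phi> \<alpha>" if "0 < \<alpha>"
    unfolding infimum_transform(2)[OF that, symmetric]
    by (intro integral_cong_AE eq[OF that] infimum_transform(1)[OF that]) measurable
qed

end

end

section \<open>Laplace exponents\<close>

lemma laplace_exponent_slope:
  fixes X :: "'a \<Rightarrow> real"
  assumes "prob_space M"
    and X: "integrable M X" and int: "integrable M (\<lambda>\<omega>. exp (- X \<omega>))"
    and exponent: "\<And>\<alpha>. 0 \<le> \<alpha> \<Longrightarrow> (LINT \<omega>|M. exp (- \<alpha> * X \<omega>)) = exp (\<psi> \<alpha>)"
  shows "((\<lambda>\<alpha>. \<psi> \<alpha> / \<alpha>) \<longlongrightarrow> - (LINT \<omega>|M. X \<omega>)) (at_right 0)"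
proof -
  interpret prob_space M by fact
  have at0: "at (0::real) within {0..} = at_right 0" by (simp add: at_within_Ici_at_right)
  define E where "E \<alpha> = (LINT \<omega>|M. exp (- \<alpha> * X \<omega>))" for \<alpha>
  have E0: "E 0 = 1" by (simp add: E_def prob_space)
  have "(E has_real_derivative - (LINT \<omega>|M. X \<omega>)) (at 0 within {0..})"
    using laplace_transform_deriv_0[OF assms(1) X int] E0
    unfolding has_field_derivative_iff at0 E_def by simp
  then have "((\<lambda>\<alpha>. ln (E \<alpha>)) has_real_derivative - (LINT \<omega>|M. X \<omega>)) (at 0 within {0..})"
    by (auto intro!: derivative_eq_intros simp: E0)
  then have "((\<lambda>\<alpha>. ln (E \<alpha>) / \<alpha>) \<longlongrightarrow> - (LINT \<omega>|M. X \<omega>)) (at_right 0)"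
    unfolding has_field_derivative_iff at0 by (simp add: E0)
  moreover have "\<forall>\<^sub>F \<alpha> in at_right 0. ln (E \<alpha>) / \<alpha> = \<psi> \<alpha> / \<alpha>"
    using eventually_at_right_less[of 0] by eventually_elim (use exponent in \<open>simp add: E_def\<close>)
  ultimately show ?thesis by (rule Lim_transform_eventually)
qed

text \<open>For \<open>0 < x \<le> 1\<close> the integrand is at most \<open>(\<alpha> x)\<^sup>2\<close>, and for \<open>x > 1\<close> it is at most \<open>0\<close>.\<close>

lemma up_exponent_quadratic_growth:
  assumes \<nu>: "upward_levy_measure \<nu>" and "1 \<le> \<alpha>"
  shows "up_exponent c \<sigma> \<nu> \<alpha> \<le> (\<bar>c\<bar> + \<sigma>\<^sup>2 / 2 + (LINT x|\<nu>. min 1 (x\<^sup>2))) * \<alpha>\<^sup>2"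
proof -
  have int: "integrable \<nu> (\<lambda>x. min 1 (x\<^sup>2))" using \<nu> by (simp add: upward_levy_measure_def)
  have "(LINT x:{0<..}|\<nu>. exp (- \<alpha> * x) - 1 + \<alpha> * x * indicator {..1} x) \<le> (LINT x|\<nu>. \<alpha>\<^sup>2 * min 1 (x\<^sup>2))"
    unfolding set_lebesgue_integral_def
  proof (rule integral_mono')
    show "integrable \<nu> (\<lambda>x. \<alpha>\<^sup>2 * min 1 (x\<^sup>2))" using int by simp
    show "indicat_real {0<..} x *\<^sub>R (exp (- \<alpha> * x) - 1 + \<alpha> * x * indicator {..1} x) \<le> \<alpha>\<^sup>2 * min 1 (x\<^sup>2)" for x
    proof (cases "0 < x")
      case x: True
      show ?thesis
      proof (cases "x \<le> 1")
        case True
        define y where "y = \<alpha> * x"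
        have y: "0 \<le> y" using x assms(2) by (simp add: y_def)
        have "(1 + y) * exp (- y) \<le> exp y * exp (- y)"
          by (rule mult_right_mono[OF exp_ge_add_one_self]) simp
        then have "exp (- y) - 1 + y \<le> y * (1 - exp (- y))"
          by (simp add: exp_add[symmetric] algebra_simps)
        also have "\<dots> \<le> y * y"
          using exp_ge_add_one_self[of "- y"] y by (intro mult_left_mono) auto
        finally have "exp (- y) - 1 + y \<le> y * y" .
        moreover have "min 1 (x\<^sup>2) = x\<^sup>2" using x True by (simp add: power_le_one)
        moreover have "y * y = \<alpha>\<^sup>2 * x\<^sup>2" by (simp add: y_def power2_eq_square)
        moreover have "indicat_real {0<..} x *\<^sub>R (exp (- \<alpha> * x) - 1 + \<alpha> * x * indicator {..1} x) = exp (- y) - 1 + y"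
          using x True by (simp add: y_def)
        ultimately show ?thesis by simp
      next
        case False
        have "exp (- \<alpha> * x) - 1 \<le> 0" using x assms(2) by simp
        moreover have "0 \<le> \<alpha>\<^sup>2 * min 1 (x\<^sup>2)" by simp
        moreover have "indicat_real {0<..} x *\<^sub>R (exp (- \<alpha> * x) - 1 + \<alpha> * x * indicator {..1} x) = exp (- \<alpha> * x) - 1"
          using x False by simp
        ultimately show ?thesis by linarith
      qed
    qed auto
  qed auto
  moreover have "- c * \<alpha> \<le> \<bar>c\<bar> * \<alpha>\<^sup>2"
  proof -
    have "- c * \<alpha> \<le> \<bar>c\<bar> * \<alpha>" using assms(2) by (intro mult_right_mono) auto
    also have "\<dots> \<le> \<bar>c\<bar> * \<alpha>\<^sup>2" using assms(2) by (intro mult_left_mono) (auto simp: power2_eq_square)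
    finally show ?thesis .
  qed
  ultimately show ?thesis
    unfolding up_exponent_def by (simp add: algebra_simps)
qed

lemma AE_levy_pos:
  assumes "sets \<nu> = sets borel" "emeasure \<nu> {..0::real} = 0"
  shows "AE x in \<nu>. 0 < x"
proof (rule AE_I[where N="{..0}"])
  show "{x \<in> space \<nu>. \<not> 0 < x} \<subseteq> {..0}" by auto
qed (use assms in auto)

lemma integrable_one_minus_exp:
  assumes \<nu>: "subordinator_levy_measure \<nu>" and "0 \<le> \<alpha>"
  shows "integrable \<nu> (\<lambda>x. 1 - exp (- \<alpha> * x))"
proof (rule Bochner_Integration.integrable_bound)
  show "integrable \<nu> (\<lambda>x. (1 + \<alpha>) * min 1 x)"
    using \<nu> by (simp add: subordinator_levy_measure_def)
  have sets: "sets \<nu> = sets borel" using \<nu> by (simp add: subordinator_levy_measure_def)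
  show "(\<lambda>x. 1 - exp (- \<alpha> * x)) \<in> borel_measurable \<nu>"
    unfolding measurable_cong_sets[OF sets refl] by measurable
  have "AE x in \<nu>. 0 < x" using \<nu> by (intro AE_levy_pos) (auto simp: subordinator_levy_measure_def)
  then show "AE x in \<nu>. norm (1 - exp (- \<alpha> * x)) \<le> norm ((1 + \<alpha>) * min 1 x)"
  proof eventually_elim
    case (elim x)
    have "1 - exp (- \<alpha> * x) \<le> (1 + \<alpha>) * min 1 x"
    proof (cases "x \<le> 1")
      case True
      have "1 - exp (- \<alpha> * x) \<le> \<alpha> * x" using exp_ge_add_one_self[of "- \<alpha> * x"] by linarith
      also have "\<dots> \<le> (1 + \<alpha>) * x" using elim by (simp add: algebra_simps)
      finally show ?thesis using True by simp
    next
      case False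
      then have "min 1 x = 1" by simp
      show ?thesis
        unfolding \<open>min 1 x = 1\<close> mult_1_right using assms(2) exp_gt_zero[of "- \<alpha> * x"] by linarith
    qed
    moreover have "0 \<le> 1 - exp (- \<alpha> * x)" using assms(2) elim by simp
    ultimately show ?case by (simp only: real_norm_def)
  qed
qed

lemma down_exponent_eq:
  assumes "subordinator_levy_measure \<nu>"
  shows "down_exponent c \<nu> \<alpha> = c * \<alpha> + (LINT x|\<nu>. 1 - exp (- \<alpha> * x))"
proof -
  have sets: "sets \<nu> = sets borel" using assms by (simp add: subordinator_levy_measure_def)
  have m: "(\<lambda>x. 1 - exp (- \<alpha> * x)) \<in> borel_measurable \<nu>" "(\<lambda>x. indicat_real {0<..} x * (1 - exp (- \<alpha> * x))) \<in> borel_measurable \<nu>"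
    unfolding measurable_cong_sets[OF sets refl] by measurable
  have pos: "AE x in \<nu>. 0 < x" using assms by (intro AE_levy_pos) (auto simp: subordinator_levy_measure_def)
  have "(LINT x:{0<..}|\<nu>. 1 - exp (- \<alpha> * x)) = (LINT x|\<nu>. 1 - exp (- \<alpha> * x))"
    unfolding set_lebesgue_integral_def real_scaleR_def
    by (intro integral_cong_AE m eventually_mono[OF pos]) simp
  then show ?thesis by (simp add: down_exponent_def)
qed

text \<open>Difference quotients of the exponent at \<open>0\<close> are integrals of \<open>n (1 - exp (- x / n))\<close>, which
  converges to \<open>x\<close> from below. A finite slope therefore bounds the mean of the Levy measure by Fatou's lemma, and
  then dominated convergence identifies it.\<close>

lemma down_exponent_slope:
  assumes \<nu>: "subordinator_levy_measure \<nu>"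
    and slope: "((\<lambda>\<alpha>. down_exponent c \<nu> \<alpha> / \<alpha>) \<longlongrightarrow> K) (at_right 0)"
  shows "integrable \<nu> (\<lambda>x. x)" and "K = c + (LINT x|\<nu>. x)"
proof -
  have sets: "sets \<nu> = sets borel" using \<nu> by (simp add: subordinator_levy_measure_def)
  have pos: "AE x in \<nu>. 0 < x" using \<nu> by (intro AE_levy_pos) (auto simp: subordinator_levy_measure_def)
  define g where "g n x = real (Suc n) * (1 - exp (- (1 / real (Suc n)) * x))" for n x
  have g_meas [measurable]: "g n \<in> borel_measurable \<nu>" for n
    unfolding measurable_cong_sets[OF sets refl] g_def by measurable
  have id_meas [measurable]: "(\<lambda>x. x) \<in> borel_measurable \<nu>"
    unfolding measurable_cong_sets[OF sets refl] by measurable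
  have g_int: "integrable \<nu> (g n)" for n
    unfolding g_def by (intro integrable_mult_right integrable_one_minus_exp \<nu>) auto
  have g_nonneg: "AE x in \<nu>. 0 \<le> g n x" for n
    using pos by eventually_elim (simp add: g_def)
  have g_le: "g n x \<le> x" for n x
  proof -
    have "1 - exp (- (1 / real (Suc n)) * x) \<le> 1 / real (Suc n) * x"
      using exp_ge_add_one_self[of "- (1 / real (Suc n)) * x"] by linarith
    then have "g n x \<le> real (Suc n) * (1 / real (Suc n) * x)"
      unfolding g_def by (intro mult_left_mono) auto
    then show ?thesis by simp
  qed
  have mesh: "filterlim (\<lambda>n. 1 / real (Suc n)) (at_right 0) sequentially"
    by real_asymp
  have g_lim: "(\<lambda>n. g n x) \<longlonglongrightarrow> x" for x
  proof -
    have "- ((E - 1) / (1 / N)) = N * (1 - E)" if "0 < N" for N E :: real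
      using that by (simp add: field_simps)
    then have "- ((exp (- (1 / real (Suc n)) * x) - 1) / (1 / real (Suc n))) = g n x" for n
      unfolding g_def by this simp
    with tendsto_minus[OF filterlim_compose[OF tendsto_exp_diff_quotient[of x] mesh]] show ?thesis
      by (simp only: minus_minus)
  qed
  from filterlim_compose[OF slope mesh]
  have "(\<lambda>n. down_exponent c \<nu> (1 / real (Suc n)) / (1 / real (Suc n))) \<longlonglongrightarrow> K" .
  moreover have "down_exponent c \<nu> (1 / real (Suc n)) / (1 / real (Suc n)) = c + (LINT x|\<nu>. g n x)" for n
  proof -
    have "(c * (1 / N) + I) / (1 / N) = c + N * I" if "0 < N" for N I :: real
      using that by (simp add: field_simps)
    then show ?thesis
      unfolding down_exponent_eq[OF \<nu>] g_def integral_mult_right_zero by this simp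
  qed
  ultimately have K: "(\<lambda>n. c + (LINT x|\<nu>. g n x)) \<longlonglongrightarrow> K" by simp
  have "(\<integral>\<^sup>+x. ennreal x \<partial>\<nu>) = (\<integral>\<^sup>+x. liminf (\<lambda>n. ennreal (g n x)) \<partial>\<nu>)"
    by (intro nn_integral_cong lim_imp_Liminf[symmetric] tendsto_ennrealI g_lim) simp
  also have "\<dots> \<le> liminf (\<lambda>n. \<integral>\<^sup>+x. ennreal (g n x) \<partial>\<nu>)"
    by (rule nn_integral_liminf) simp
  also have "\<dots> = ennreal (K - c)"
  proof (rule lim_imp_Liminf)
    have "(\<integral>\<^sup>+x. ennreal (g n x) \<partial>\<nu>) = ennreal ((c + (LINT x|\<nu>. g n x)) - c)" for n
      by (simp add: nn_integral_eq_integral[OF g_int g_nonneg])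
    then show "(\<lambda>n. \<integral>\<^sup>+x. ennreal (g n x) \<partial>\<nu>) \<longlonglongrightarrow> ennreal (K - c)"
      by (simp only:) (intro tendsto_ennrealI tendsto_diff K tendsto_const)
  qed simp
  finally have "(\<integral>\<^sup>+x. ennreal x \<partial>\<nu>) < \<infinity>"
    by (rule le_less_trans) simp
  then show int: "integrable \<nu> (\<lambda>x. x)"
    by (intro integrableI_nonneg id_meas eventually_mono[OF pos]) auto
  have "(\<lambda>n. LINT x|\<nu>. g n x) \<longlonglongrightarrow> (LINT x|\<nu>. x)"
  proof (rule integral_dominated_convergence[where w="\<lambda>x. x"])
    show "AE x in \<nu>. norm (g n x) \<le> x" for n
      using g_nonneg[of n] by eventually_elim (simp add: g_le)
    show "AE x in \<nu>. (\<lambda>n. g n x) \<longlonglongrightarrow> x" by (intro AE_I2 g_lim)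
  qed (rule id_meas g_meas int)+
  then have "(\<lambda>n. c + (LINT x|\<nu>. g n x)) \<longlonglongrightarrow> c + (LINT x|\<nu>. x)"
    by (intro tendsto_intros)
  with K show "K = c + (LINT x|\<nu>. x)" by (rule LIMSEQ_unique)
qed

section \<open>The excess law of the subordinator\<close>

lemma measurable_tail:
  fixes \<kappa> :: "real measure"
  assumes "sigma_finite_measure \<kappa>" "sets \<kappa> = sets borel"
  shows "(\<lambda>t. emeasure \<kappa> {t<..}) \<in> borel_measurable borel"
proof -
  interpret sigma_finite_measure \<kappa> by fact
  have "{p :: real \<times> real. fst p < snd p} \<in> sets (borel \<Otimes>\<^sub>M borel)"
    unfolding borel_prod by (intro borel_open open_Collect_less continuous_intros)
  then have "{p :: real \<times> real. fst p < snd p} \<in> sets (borel \<Otimes>\<^sub>M \<kappa>)"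
    by (simp cong: sets_pair_measure_cong add: assms(2))
  from measurable_emeasure_Pair[OF this] show ?thesis
    by (simp add: vimage_def greaterThan_def)
qed

text \<open>Both sides integrate \<open>h t\<close> over the region \<open>0 < t < x\<close>.\<close>

lemma nn_integral_tail:
  fixes h :: "real \<Rightarrow> ennreal"
  assumes "sigma_finite_measure \<kappa>" and sets [measurable_cong]: "sets \<kappa> = sets borel"
    and [measurable]: "h \<in> borel_measurable borel"
  shows "(\<integral>\<^sup>+t. h t * indicator {0<..} t * emeasure \<kappa> {t<..} \<partial>lborel) =
    (\<integral>\<^sup>+x. (\<integral>\<^sup>+t. h t * indicator {0<..<x} t \<partial>lborel) \<partial>\<kappa>)"
proof -
  interpret sigma_finite_measure \<kappa> by fact
  interpret pair_sigma_finite lborel \<kappa> ..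
  have "(\<integral>\<^sup>+t. h t * indicator {0<..} t * emeasure \<kappa> {t<..} \<partial>lborel) =
      (\<integral>\<^sup>+t. (\<integral>\<^sup>+x. h t * indicator {0<..} t * indicator {p. fst p < snd p} (t, x) \<partial>\<kappa>) \<partial>lborel)"
  proof (intro nn_integral_cong)
    fix t :: real
    have "(\<integral>\<^sup>+x. h t * indicator {0<..} t * indicator {p. fst p < snd p} (t, x) \<partial>\<kappa>) =
        (\<integral>\<^sup>+x. h t * indicator {0<..} t * indicator {t<..} x \<partial>\<kappa>)"
      by (intro nn_integral_cong) (auto simp: indicator_def)
    then show "h t * indicator {0<..} t * emeasure \<kappa> {t<..} =
        (\<integral>\<^sup>+x. h t * indicator {0<..} t * indicator {p. fst p < snd p} (t, x) \<partial>\<kappa>)"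
      by (simp add: nn_integral_cmult)
  qed
  also have "\<dots> = (\<integral>\<^sup>+x. (\<integral>\<^sup>+t. h t * indicator {0<..} t * indicator {p. fst p < snd p} (t, x) \<partial>lborel) \<partial>\<kappa>)"
  proof (rule Fubini'[symmetric])
    have [measurable]: "{p :: real \<times> real. fst p < snd p} \<in> sets (borel \<Otimes>\<^sub>M borel)"
      unfolding borel_prod by (intro borel_open open_Collect_less continuous_intros)
    show "(\<lambda>(t, x). h t * indicator {0<..} t * indicator {p. fst p < snd p} (t, x)) \<in> borel_measurable (lborel \<Otimes>\<^sub>M \<kappa>)"
      by measurable
  qed
  also have "\<dots> = (\<integral>\<^sup>+x. (\<integral>\<^sup>+t. h t * indicator {0<..<x} t \<partial>lborel) \<partial>\<kappa>)"
    by (intro nn_integral_cong) (auto simp: indicator_def)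
  finally show ?thesis .
qed

lemma nn_integral_derivative_interval:
  fixes f F :: "real \<Rightarrow> real"
  assumes [measurable]: "f \<in> borel_measurable borel"
    and "\<And>t. 0 \<le> t \<Longrightarrow> (F has_real_derivative f t) (at t)" "\<And>t. 0 \<le> t \<Longrightarrow> 0 \<le> f t" "0 \<le> x"
  shows "(\<integral>\<^sup>+t. ennreal (f t) * indicator {0<..<x} t \<partial>lborel) = ennreal (F x - F 0)"
proof -
  have "(\<integral>\<^sup>+t. ennreal (f t) * indicator {0<..<x} t \<partial>lborel) = (\<integral>\<^sup>+t. ennreal (f t) * indicator {0..x} t \<partial>lborel)"
  proof (rule nn_integral_cong_AE)
    have "AE t in lborel. t \<noteq> 0" "AE t in lborel. t \<noteq> x" by (auto intro: AE_lborel_singleton)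
    then show "AE t in lborel. ennreal (f t) * indicator {0<..<x} t = ennreal (f t) * indicator {0..x} t"
      by eventually_elim (auto simp: indicator_def)
  qed
  also have "\<dots> = ennreal (F x - F 0)"
    using assms by (intro nn_integral_FTC_Icc) auto
  finally show ?thesis .
qed

text \<open>A multiple of \<open>min 1 x\<close> dominates the indicator of \<open>{t<..}\<close>, by Markov's argument.\<close>

lemma sigma_finite_subordinator_levy_measure:
  assumes \<nu>: "subordinator_levy_measure \<nu>"
  shows "sigma_finite_measure \<nu>" and "0 < t \<Longrightarrow> emeasure \<nu> {t<..} < \<infinity>"
proof -
  have sets: "sets \<nu> = sets borel" and int: "integrable \<nu> (\<lambda>x. min 1 x)" and null: "emeasure \<nu> {..0} = 0"
    using \<nu> by (auto simp: subordinator_levy_measure_def)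
  have space: "space \<nu> = UNIV" using sets_eq_imp_space_eq[OF sets] by simp
  show fin: "emeasure \<nu> {t<..} < \<infinity>" if "0 < t" for t
  proof -
    have "emeasure \<nu> {t<..} = (\<integral>\<^sup>+x. indicator {t<..} x \<partial>\<nu>)"
      using sets by (simp add: nn_integral_indicator)
    also have "\<dots> \<le> (\<integral>\<^sup>+x. ennreal (norm (1 / min 1 t * min 1 x)) \<partial>\<nu>)"
    proof (intro nn_integral_mono)
      fix x
      show "indicator {t<..} x \<le> ennreal (norm (1 / min 1 t * min 1 x))"
      proof (cases "t < x")
        case True
        then have "1 \<le> 1 / min 1 t * min 1 x" using that by (simp add: field_simps)
        then have "1 \<le> norm (1 / min 1 t * min 1 x)"
            unfolding real_norm_def by (rule order_trans[OF _ abs_ge_self])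
        then have "ennreal 1 \<le> ennreal (norm (1 / min 1 t * min 1 x))" by (rule ennreal_leI)
        then show ?thesis using True by simp
      qed simp
    qed
    also have "\<dots> < \<infinity>"
      using integrable_mult_right[OF int, of "1 / min 1 t"] unfolding integrable_iff_bounded by blast
    finally show ?thesis .
  qed
  show "sigma_finite_measure \<nu>"
  proof
    let ?A = "insert {..0} (range (\<lambda>n. {1 / real (Suc n)<..}))"
    have "x \<in> \<Union>?A" for x :: real
    proof (cases "x \<le> 0")
      case False
      then obtain n where "1 / real (Suc n) < x" using nat_approx_posE[of x] by auto
      then show ?thesis by auto
    qed auto
    then have "\<Union>?A = space \<nu>" unfolding space by blast
    moreover have "\<forall>a\<in>?A. emeasure \<nu> a \<noteq> \<infinity>"
      using null fin by (auto simp: less_top[symmetric])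
    ultimately show "\<exists>A. countable A \<and> A \<subseteq> sets \<nu> \<and> \<Union>A = space \<nu> \<and> (\<forall>a\<in>A. emeasure \<nu> a \<noteq> \<infinity>)"
      using sets by (intro exI[of _ ?A] conjI) auto
  qed
qed

text \<open>Let \<open>\<kappa>\<close> have density \<open>\<nu> {t<..}\<close> on the positive half-line. Its total mass is \<open>D - c\<close>, so the
  distribution function says that the law \<open>m\<close> and \<open>\<kappa> / D\<close> have the same tails on \<open>[0,\<infinity>)\<close>, while \<open>m\<close> has an atom of
  mass \<open>c / D\<close> at \<open>0\<close>. The function \<open>1 - exp (- \<alpha> y)\<close> vanishes at \<open>0\<close>, so its integrals depend only on the tails.
  Two more exchanges of integration reduce its integral against \<open>\<kappa>\<close> to
  the integral of \<open>x - (1 - exp (- \<alpha> x)) / \<alpha>\<close> against \<open>\<nu>\<close>.\<close>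

lemma excess_law:
  assumes \<nu>: "subordinator_levy_measure \<nu>" and int_x: "integrable \<nu> (\<lambda>x. x)"
    and c: "0 \<le> c" and D: "D = c + (LINT x|\<nu>. x)" "0 < D"
    and "real_distribution m" and cdf: "cdf m = excess_cdf c \<nu>"
  shows "AE y in m. 0 \<le> y"
    and "0 < \<alpha> \<Longrightarrow> (LINT y|m. exp (- \<alpha> * y)) = down_exponent c \<nu> \<alpha> / (D * \<alpha>)"
proof -
  interpret m: real_distribution m by fact
  have sets_\<nu> [measurable_cong]: "sets \<nu> = sets borel" using \<nu> by (simp add: subordinator_levy_measure_def)
  have pos: "AE x in \<nu>. 0 < x" using \<nu> by (intro AE_levy_pos) (auto simp: subordinator_levy_measure_def)
  then have pos_le: "AE x in \<nu>. 0 \<le> x" by eventually_elim simp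
  interpret \<nu>: sigma_finite_measure \<nu> by (rule sigma_finite_subordinator_levy_measure(1)) fact
  have fin: "emeasure \<nu> {t<..} < \<infinity>" if "0 < t" for t
    using sigma_finite_subordinator_levy_measure(2)[OF \<nu> that] .
  show nonneg: "AE y in m. 0 \<le> y"
  proof -
    have "AE y in m. \<not> y \<le> - (1 / real (Suc n))" for n
    proof -
      have "measure m {..- (1 / real (Suc n))} = 0"
        using fun_cong[OF cdf, of "- (1 / real (Suc n))"] by (simp add: cdf_def excess_cdf_def)
      then have "AE y in m. y \<notin> {..- (1 / real (Suc n))}"
        by (subst (asm) m.prob_eq_0) auto
      then show ?thesis by simp
    qed
    then have "AE y in m. \<forall>n. \<not> y \<le> - (1 / real (Suc n))" by (simp add: AE_all_countable)
    then show ?thesis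
    proof eventually_elim
      case (elim y)
      show ?case
      proof (rule ccontr)
        assume "\<not> 0 \<le> y"
        then obtain n where "1 / real (Suc n) < - y" using nat_approx_posE[of "- y"] by auto
        with elim[rule_format, of n] show False by linarith
      qed
    qed
  qed
  define \<kappa> where "\<kappa> = density lborel (\<lambda>t. ennreal (measure \<nu> {t<..}) * indicator {0<..} t)"
  have tail_meas [measurable]: "(\<lambda>t. measure \<nu> {t<..}) \<in> borel_measurable borel"
    unfolding measure_def
    using measurable_tail[OF \<nu>.sigma_finite_measure_axioms sets_\<nu>] by simp
  have \<kappa>_integral: "(\<integral>\<^sup>+t. h t \<partial>\<kappa>) = (\<integral>\<^sup>+x. (\<integral>\<^sup>+t. h t * indicator {0<..<x} t \<partial>lborel) \<partial>\<nu>)"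
    if [measurable]: "h \<in> borel_measurable borel" for h :: "real \<Rightarrow> ennreal"
  proof -
    have "(\<integral>\<^sup>+t. h t \<partial>\<kappa>) = (\<integral>\<^sup>+t. h t * indicator {0<..} t * emeasure \<nu> {t<..} \<partial>lborel)"
      unfolding \<kappa>_def
    proof (subst nn_integral_density)
      show "(\<integral>\<^sup>+t. ennreal (measure \<nu> {t<..}) * indicator {0<..} t * h t \<partial>lborel) =
          (\<integral>\<^sup>+t. h t * indicator {0<..} t * emeasure \<nu> {t<..} \<partial>lborel)"
      proof (intro nn_integral_cong)
        fix t :: real
        have "0 < t \<Longrightarrow> ennreal (measure \<nu> {t<..}) = emeasure \<nu> {t<..}"
          using fin[of t] by (intro emeasure_eq_ennreal_measure[symmetric]) (auto simp: less_top[symmetric])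
        then show "ennreal (measure \<nu> {t<..}) * indicator {0<..} t * h t = h t * indicator {0<..} t * emeasure \<nu> {t<..}"
          by (auto simp: indicator_def mult.commute)
      qed
    qed auto
    also have "\<dots> = (\<integral>\<^sup>+x. (\<integral>\<^sup>+t. h t * indicator {0<..<x} t \<partial>lborel) \<partial>\<nu>)"
      by (rule nn_integral_tail) (auto simp: sets_\<nu> \<nu>.sigma_finite_measure_axioms)
    finally show ?thesis .
  qed
  have sets_\<kappa> [measurable_cong]: "sets \<kappa> = sets borel" by (simp add: \<kappa>_def)
  have space_\<kappa>: "space \<kappa> = UNIV" by (simp add: \<kappa>_def)
  have total: "emeasure \<kappa> UNIV = ennreal (D - c)"
  proof -
    have "emeasure \<kappa> UNIV = (\<integral>\<^sup>+t. 1 \<partial>\<kappa>)" by (simp add: space_\<kappa>)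
    also have "\<dots> = (\<integral>\<^sup>+x. (\<integral>\<^sup>+t. 1 * indicator {0<..<x} t \<partial>lborel) \<partial>\<nu>)"
      by (rule \<kappa>_integral) simp
    also have "\<dots> = (\<integral>\<^sup>+x. ennreal x \<partial>\<nu>)"
      by (intro nn_integral_cong_AE eventually_mono[OF pos]) auto
    also have "\<dots> = ennreal (D - c)"
      using nn_integral_eq_integral[OF int_x pos_le] D by simp
    finally show ?thesis .
  qed
  interpret \<kappa>: finite_measure \<kappa>
    by standard (simp add: space_\<kappa> total)
  have "0 \<le> D - c" unfolding D using integral_nonneg_AE[OF pos_le] by simp
  then have total': "measure \<kappa> UNIV = D - c" using total by (simp add: measure_def)
  have tail: "emeasure m {t<..} = ennreal (1 / D) * emeasure \<kappa> {t<..}" if "0 \<le> t" for t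
  proof -
    have D_eq: "c + (LINT x:{0<..}|\<nu>. x) = D"
    proof -
      have "(LINT x:{0<..}|\<nu>. x) = (LINT x|\<nu>. x)"
        unfolding set_lebesgue_integral_def
        by (intro integral_cong_AE eventually_mono[OF pos]) auto
      then show ?thesis by (simp add: D)
    qed
    have "(LINT x:{0..t}|lborel. measure \<nu> {x<..}) = measure \<kappa> {..t}"
    proof -
      have "(LINT x:{0..t}|lborel. measure \<nu> {x<..}) = enn2real (\<integral>\<^sup>+x. ennreal (indicator {0..t} x * measure \<nu> {x<..}) \<partial>lborel)"
        unfolding set_lebesgue_integral_def real_scaleR_def
        by (intro integral_eq_nn_integral) auto
      also have "(\<integral>\<^sup>+x. ennreal (indicator {0..t} x * measure \<nu> {x<..}) \<partial>lborel) = emeasure \<kappa> {..t}"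
      proof -
        have "emeasure \<kappa> {..t} = (\<integral>\<^sup>+x. ennreal (measure \<nu> {x<..}) * indicator {0<..} x * indicator {..t} x \<partial>lborel)"
          unfolding \<kappa>_def by (subst emeasure_density) auto
        also have "\<dots> = (\<integral>\<^sup>+x. ennreal (indicator {0..t} x * measure \<nu> {x<..}) \<partial>lborel)"
        proof (rule nn_integral_cong_AE)
          have "AE x in lborel. x \<noteq> (0::real)" by (rule AE_lborel_singleton)
          then show "AE x in lborel. ennreal (measure \<nu> {x<..}) * indicator {0<..} x * indicator {..t} x =
              ennreal (indicator {0..t} x * measure \<nu> {x<..})"
            by eventually_elim (auto simp: indicator_def)
        qed
        finally show ?thesis by simp
      qed
      finally show ?thesis by (simp add: measure_def)
    qed
    then have "measure m {..t} = 1 / D * (c + measure \<kappa> {..t})"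
      using fun_cong[OF cdf, of t] that D_eq by (simp add: cdf_def excess_cdf_def)
    moreover have "measure m {t<..} = 1 - measure m {..t}"
    proof -
      have "{t<..} = UNIV - {..t}" by auto
      then show ?thesis using m.prob_compl[of "{..t}"] by simp
    qed
    moreover have "measure \<kappa> {t<..} = D - c - measure \<kappa> {..t}"
    proof -
      have "{t<..} = UNIV - {..t}" by auto
      then show ?thesis using \<kappa>.finite_measure_compl[of "{..t}"] total' by (simp add: space_\<kappa> sets_\<kappa>)
    qed
    moreover have "1 - 1 / D * (c + k) = 1 / D * (D - c - k)" for k
      using D(2) by (simp add: field_simps)
    ultimately have "measure m {t<..} = 1 / D * measure \<kappa> {t<..}" by (simp only:)
    then show ?thesis
      using D(2) by (simp add: m.emeasure_eq_measure \<kappa>.emeasure_eq_measure ennreal_mult[symmetric] del: divide_inverse)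
  qed
  show "(LINT y|m. exp (- \<alpha> * y)) = down_exponent c \<nu> \<alpha> / (D * \<alpha>)" if \<alpha>: "0 < \<alpha>"
  proof -
    let ?e = "\<lambda>t. \<alpha> * exp (- \<alpha> * t)"
    have inner1: "(\<integral>\<^sup>+t. ennreal (?e t) * indicator {0<..<x} t \<partial>lborel) = ennreal (1 - exp (- \<alpha> * x))" if "0 \<le> x" for x
      using nn_integral_derivative_interval[of ?e "\<lambda>t. - exp (- \<alpha> * t)" x] that \<alpha>
      by (force intro!: derivative_eq_intros)
    have inner2: "(\<integral>\<^sup>+t. ennreal (1 - exp (- \<alpha> * t)) * indicator {0<..<x} t \<partial>lborel) =
        ennreal (x - (1 - exp (- \<alpha> * x)) / \<alpha>)" if "0 \<le> x" for x
    proof -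
      have "(\<integral>\<^sup>+t. ennreal (1 - exp (- \<alpha> * t)) * indicator {0<..<x} t \<partial>lborel) =
        ennreal ((x + exp (- \<alpha> * x) / \<alpha>) - (0 + exp (- \<alpha> * 0) / \<alpha>))"
        using that \<alpha> by (intro nn_integral_derivative_interval) (auto intro!: derivative_eq_intros)
      then show ?thesis by (simp add: diff_divide_distrib algebra_simps)
    qed
    have int_e: "integrable m (\<lambda>y. exp (- \<alpha> * y))"
      using \<alpha> by (intro m.integrable_const_bound[where B=1] eventually_mono[OF nonneg]) auto
    have AE\<kappa>: "AE x in \<kappa>. 0 \<le> x"
      unfolding \<kappa>_def by (subst AE_density) (auto simp: indicator_def)
    have gap_nonneg: "0 \<le> x - (1 - exp (- \<alpha> * x)) / \<alpha>" for x
    proof -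
      have "(1 - exp (- \<alpha> * x)) / \<alpha> \<le> \<alpha> * x / \<alpha>"
        using exp_ge_add_one_self[of "- \<alpha> * x"] \<alpha> by (intro divide_right_mono) auto
      then show ?thesis using \<alpha> by simp
    qed
    have gap: "(LINT x|\<nu>. x - (1 - exp (- \<alpha> * x)) / \<alpha>) = (D - c) - (LINT x|\<nu>. 1 - exp (- \<alpha> * x)) / \<alpha>"
    proof -
      have "integrable \<nu> (\<lambda>x. (1 - exp (- \<alpha> * x)) / \<alpha>)"
        using \<alpha> by (intro integrable_divide integrable_one_minus_exp \<nu>) simp
      then show ?thesis
        unfolding D by (subst Bochner_Integration.integral_diff[OF int_x]) simp_all
    qed
    have "(\<integral>\<^sup>+y. ennreal (1 - exp (- \<alpha> * y)) \<partial>m) = (\<integral>\<^sup>+y. (\<integral>\<^sup>+t. ennreal (?e t) * indicator {0<..<y} t \<partial>lborel) \<partial>m)"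
      by (intro nn_integral_cong_AE eventually_mono[OF nonneg] inner1[symmetric])
    also have "\<dots> = (\<integral>\<^sup>+t. ennreal (?e t) * indicator {0<..} t * emeasure m {t<..} \<partial>lborel)"
      by (rule nn_integral_tail[symmetric]) (auto simp: m.sigma_finite_measure_axioms)
    also have "\<dots> = (\<integral>\<^sup>+t. ennreal (1 / D) * (ennreal (?e t) * indicator {0<..} t * emeasure \<kappa> {t<..}) \<partial>lborel)"
      by (intro nn_integral_cong) (auto simp: indicator_def tail mult.left_commute)
    also have "\<dots> = ennreal (1 / D) * (\<integral>\<^sup>+t. ennreal (?e t) * indicator {0<..} t * emeasure \<kappa> {t<..} \<partial>lborel)"
    proof (rule nn_integral_cmult)
      have "(\<lambda>t. emeasure \<kappa> {t<..}) \<in> borel_measurable borel"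
        by (rule measurable_tail) (simp_all add: \<kappa>.sigma_finite_measure_axioms sets_\<kappa>)
      then show "(\<lambda>t. ennreal (?e t) * indicator {0<..} t * emeasure \<kappa> {t<..}) \<in> borel_measurable lborel"
        by simp
    qed
    also have "(\<integral>\<^sup>+t. ennreal (?e t) * indicator {0<..} t * emeasure \<kappa> {t<..} \<partial>lborel) =
        (\<integral>\<^sup>+x. (\<integral>\<^sup>+t. ennreal (?e t) * indicator {0<..<x} t \<partial>lborel) \<partial>\<kappa>)"
      by (rule nn_integral_tail) (auto simp: \<kappa>.sigma_finite_measure_axioms sets_\<kappa>)
    also have "\<dots> = (\<integral>\<^sup>+x. ennreal (1 - exp (- \<alpha> * x)) \<partial>\<kappa>)"
      by (intro nn_integral_cong_AE eventually_mono[OF AE\<kappa>] inner1)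
    also have "\<dots> = (\<integral>\<^sup>+x. (\<integral>\<^sup>+t. ennreal (1 - exp (- \<alpha> * t)) * indicator {0<..<x} t \<partial>lborel) \<partial>\<nu>)"
      by (rule \<kappa>_integral) simp
    also have "\<dots> = (\<integral>\<^sup>+x. ennreal (x - (1 - exp (- \<alpha> * x)) / \<alpha>) \<partial>\<nu>)"
      by (intro nn_integral_cong_AE eventually_mono[OF pos_le] inner2)
    also have "\<dots> = ennreal (LINT x|\<nu>. x - (1 - exp (- \<alpha> * x)) / \<alpha>)"
    proof (rule nn_integral_eq_integral)
      show "integrable \<nu> (\<lambda>x. x - (1 - exp (- \<alpha> * x)) / \<alpha>)"
        using \<alpha> by (intro Bochner_Integration.integrable_diff int_x integrable_divide integrable_one_minus_exp \<nu>) auto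
      show "AE x in \<nu>. 0 \<le> x - (1 - exp (- \<alpha> * x)) / \<alpha>" using gap_nonneg by simp
    qed
    also note gap
    finally have "(\<integral>\<^sup>+y. ennreal (1 - exp (- \<alpha> * y)) \<partial>m) =
        ennreal (1 / D) * ennreal (D - c - (LINT x|\<nu>. 1 - exp (- \<alpha> * x)) / \<alpha>)" .
    moreover have "0 \<le> D - c - (LINT x|\<nu>. 1 - exp (- \<alpha> * x)) / \<alpha>"
      unfolding gap[symmetric] using gap_nonneg by (intro integral_nonneg_AE) simp
    moreover have "(\<integral>\<^sup>+y. ennreal (1 - exp (- \<alpha> * y)) \<partial>m) = ennreal (LINT y|m. 1 - exp (- \<alpha> * y))"
      using \<alpha> int_e
      by (intro nn_integral_eq_integral eventually_mono[OF nonneg] Bochner_Integration.integrable_diff) auto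
    moreover have "0 \<le> (LINT y|m. 1 - exp (- \<alpha> * y))"
      using \<alpha> by (intro integral_nonneg_AE eventually_mono[OF nonneg]) auto
    ultimately have "(LINT y|m. 1 - exp (- \<alpha> * y)) = 1 / D * (D - c - (LINT x|\<nu>. 1 - exp (- \<alpha> * x)) / \<alpha>)"
      using D(2) by (simp add: ennreal_mult[symmetric] ennreal_inj del: divide_inverse)
    moreover have "(LINT y|m. 1 - exp (- \<alpha> * y)) = 1 - (LINT y|m. exp (- \<alpha> * y))"
      by (subst Bochner_Integration.integral_diff[OF _ int_e]) (simp_all add: m.prob_space[unfolded m.space_eq_univ])
    ultimately have "(LINT y|m. exp (- \<alpha> * y)) = 1 - 1 / D * (D - c - (LINT x|\<nu>. 1 - exp (- \<alpha> * x)) / \<alpha>)"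
      by linarith
    also have "1 - 1 / D * (D - c - I / \<alpha>) = (c * \<alpha> + I) / (D * \<alpha>)" for I
      using D(2) \<alpha> by (simp add: field_simps)
    finally show ?thesis
      unfolding down_exponent_eq[OF \<nu>] .
  qed
qed

section \<open>The mixture\<close>

lemma (in prob_space) indep_expectation_product_5:
  fixes A B C D E :: "'a \<Rightarrow> real"
  assumes indep: "indep_vars (\<lambda>_. borel) (\<lambda>i. [A, B, C, D, E] ! i) {..<5}"
    and [measurable]: "a \<in> borel_measurable borel" "b \<in> borel_measurable borel" "c \<in> borel_measurable borel"
      "d \<in> borel_measurable borel" "e \<in> borel_measurable borel"
    and int: "integrable M (\<lambda>\<omega>. a (A \<omega>))" "integrable M (\<lambda>\<omega>. b (B \<omega>))" "integrable M (\<lambda>\<omega>. c (C \<omega>))"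
      "integrable M (\<lambda>\<omega>. d (D \<omega>))" "integrable M (\<lambda>\<omega>. e (E \<omega>) :: real)"
  shows "integrable M (\<lambda>\<omega>. a (A \<omega>) * b (B \<omega>) * c (C \<omega>) * d (D \<omega>) * e (E \<omega>))"
    and "expectation (\<lambda>\<omega>. a (A \<omega>) * b (B \<omega>) * c (C \<omega>) * d (D \<omega>) * e (E \<omega>)) =
      expectation (\<lambda>\<omega>. a (A \<omega>)) * expectation (\<lambda>\<omega>. b (B \<omega>)) * expectation (\<lambda>\<omega>. c (C \<omega>)) *
      expectation (\<lambda>\<omega>. d (D \<omega>)) * expectation (\<lambda>\<omega>. e (E \<omega>))"
proof -
  define Z where "Z = (\<lambda>i. [\<lambda>\<omega>. a (A \<omega>), \<lambda>\<omega>. b (B \<omega>), \<lambda>\<omega>. c (C \<omega>), \<lambda>\<omega>. d (D \<omega>), \<lambda>\<omega>. e (E \<omega>)] ! i)"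
  have lt5: "{..<5::nat} = {0, 1, 2, 3, 4}" by auto
  have "indep_vars (\<lambda>_. borel) (\<lambda>i \<omega>. ([a, b, c, d, e] ! i) (([A, B, C, D, E] ! i) \<omega>)) {..<5}"
    by (rule indep_vars_compose2[OF indep]) (auto simp: lt5)
  also have "?this \<longleftrightarrow> indep_vars (\<lambda>_. borel) Z {..<5}"
    by (rule indep_vars_cong) (auto simp: lt5 Z_def)
  finally have Z: "indep_vars (\<lambda>_. borel) Z {..<5}" .
  have Z_int: "integrable M (Z i)" if "i \<in> {..<5}" for i
    using that int by (auto simp: lt5 Z_def)
  have prod: "(\<Prod>i\<in>{..<5::nat}. f i) = f 0 * f 1 * f 2 * f 3 * f 4" for f :: "nat \<Rightarrow> real"
    by (simp add: lt5 mult.assoc)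
  from indep_vars_integrable[OF _ Z Z_int] indep_vars_lebesgue_integral[OF _ Z Z_int]
  show "integrable M (\<lambda>\<omega>. a (A \<omega>) * b (B \<omega>) * c (C \<omega>) * d (D \<omega>) * e (E \<omega>))"
    and "expectation (\<lambda>\<omega>. a (A \<omega>) * b (B \<omega>) * c (C \<omega>) * d (D \<omega>) * e (E \<omega>)) =
      expectation (\<lambda>\<omega>. a (A \<omega>)) * expectation (\<lambda>\<omega>. b (B \<omega>)) * expectation (\<lambda>\<omega>. c (C \<omega>)) *
      expectation (\<lambda>\<omega>. d (D \<omega>)) * expectation (\<lambda>\<omega>. e (E \<omega>))"
    unfolding prod by (simp_all add: Z_def)
qed

lemma (in prob_space) AE_zero_one:
  fixes I :: "'a \<Rightarrow> real"
  assumes [measurable]: "random_variable borel I"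
    and "prob {\<omega>\<in>space M. I \<omega> = 1} = p" "prob {\<omega>\<in>space M. I \<omega> = 0} = 1 - p"
  shows "AE \<omega> in M. I \<omega> = 0 \<or> I \<omega> = 1"
proof -
  have "prob ({\<omega>\<in>space M. I \<omega> = 1} \<union> {\<omega>\<in>space M. I \<omega> = 0}) = 1"
    using assms by (subst finite_measure_Union) auto
  then have "AE \<omega> in M. \<omega> \<in> {\<omega>\<in>space M. I \<omega> = 1} \<union> {\<omega>\<in>space M. I \<omega> = 0}"
    by (subst (asm) prob_eq_1) auto
  then show ?thesis by eventually_elim auto
qed

text \<open>The three terms correspond to \<open>C = 1\<close>, to \<open>C = D = 0\<close>, and to \<open>C = 0\<close> with \<open>D = 1\<close>. The variable \<open>A\<close>
  occurs in two branches of \<open>R\<close>, but these branches exclude each other, so each term is a product of functions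
  of single variables.\<close>

lemma (in prob_space) mixture_laplace_transform:
  fixes A B C D E :: "'a \<Rightarrow> real"
  assumes indep: "indep_vars (\<lambda>_. borel) (\<lambda>i. [A, B, C, D, E] ! i) {..<5}"
    and nonneg: "AE \<omega> in M. 0 \<le> A \<omega>" "AE \<omega> in M. 0 \<le> B \<omega>" "AE \<omega> in M. 0 \<le> E \<omega>"
    and C: "prob {\<omega>\<in>space M. C \<omega> = 1} = p" "prob {\<omega>\<in>space M. C \<omega> = 0} = 1 - p"
    and D: "prob {\<omega>\<in>space M. D \<omega> = 1} = q" "prob {\<omega>\<in>space M. D \<omega> = 0} = 1 - q"
    and "0 < \<alpha>"
  defines "L \<equiv> \<lambda>X. expectation (\<lambda>\<omega>. exp (- \<alpha> * X \<omega>))"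
    and "R \<equiv> \<lambda>\<omega>. C \<omega> * A \<omega> + (1 - C \<omega>) * (D \<omega> * (A \<omega> + B \<omega>) + E \<omega>)"
  shows "random_variable borel R" and "AE \<omega> in M. 0 \<le> R \<omega>"
    and "L R = p * L A + (1 - p) * (1 - q + q * L B * L A) * L E"
proof -
  have lt5: "{..<5::nat} = {0, 1, 2, 3, 4}" by auto
  have "\<forall>i\<in>{..<5::nat}. random_variable borel ([A, B, C, D, E] ! i)"
    using indep by (auto simp: indep_vars_def2)
  then have [measurable]: "random_variable borel A" "random_variable borel B" "random_variable borel C"
      "random_variable borel D" "random_variable borel E"
    by (simp_all add: lt5)
  show "random_variable borel R" unfolding R_def by measurable
  have C01: "AE \<omega> in M. C \<omega> = 0 \<or> C \<omega> = 1" and D01: "AE \<omega> in M. D \<omega> = 0 \<or> D \<omega> = 1"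
    using AE_zero_one[OF _ C] AE_zero_one[OF _ D] by auto
  show "AE \<omega> in M. 0 \<le> R \<omega>"
    using C01 D01 nonneg by eventually_elim (auto simp: R_def)
  have int: "integrable M (\<lambda>\<omega>. exp (- \<alpha> * X \<omega>))"
    if [measurable]: "random_variable borel X" and "AE \<omega> in M. 0 \<le> X \<omega>" for X
    using \<open>0 < \<alpha>\<close> by (intro integrable_const_bound[where B=1] eventually_mono[OF that(2)]) auto
  have ind: "integrable M (\<lambda>\<omega>. indicat_real {r} (X \<omega>))"
    "expectation (\<lambda>\<omega>. indicat_real {r} (X \<omega>)) = prob {\<omega>\<in>space M. X \<omega> = r}"
    if [measurable]: "random_variable borel X" for X :: "'a \<Rightarrow> real" and r
  proof -
    show "integrable M (\<lambda>\<omega>. indicat_real {r} (X \<omega>))"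
    proof (rule integrable_const_bound[where B=1])
      show "(\<lambda>\<omega>. indicat_real {r} (X \<omega>)) \<in> borel_measurable M"
        by (rule measurable_compose[OF that borel_measurable_indicator]) simp
    qed (simp add: indicator_def)
    have "expectation (\<lambda>\<omega>. indicat_real {r} (X \<omega>)) = expectation (indicator {\<omega>\<in>space M. X \<omega> = r})"
      by (intro Bochner_Integration.integral_cong) (auto simp: indicator_def)
    then show "expectation (\<lambda>\<omega>. indicat_real {r} (X \<omega>)) = prob {\<omega>\<in>space M. X \<omega> = r}" by simp
  qed
  let ?e = "\<lambda>x. exp (- \<alpha> * x)" and ?i = "\<lambda>r. indicat_real {r}"
  note prod = indep_expectation_product_5[OF indep]
  have one: "integrable M (\<lambda>\<omega>. 1 :: real)" "expectation (\<lambda>\<omega>. 1 :: real) = 1" by (simp_all add: prob_space)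
  have em: "?e \<in> borel_measurable borel" "(\<lambda>_. 1 :: real) \<in> borel_measurable borel" by measurable
  have im: "?i r \<in> borel_measurable borel" for r :: real by (rule borel_measurable_indicator) simp
  \<comment> \<open>Constant factors \<open>1\<close> bring all three terms to the shape of the product rule.\<close>
  define t1 where "t1 \<omega> = ?e (A \<omega>) * 1 * ?i 1 (C \<omega>) * 1 * 1" for \<omega>
  define t2 where "t2 \<omega> = 1 * 1 * ?i 0 (C \<omega>) * ?i 0 (D \<omega>) * ?e (E \<omega>)" for \<omega>
  define t3 where "t3 \<omega> = ?e (A \<omega>) * ?e (B \<omega>) * ?i 0 (C \<omega>) * ?i 1 (D \<omega>) * ?e (E \<omega>)" for \<omega>
  note ints = int[OF _ nonneg(1)] int[OF _ nonneg(2)] int[OF _ nonneg(3)]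
  have t1: "integrable M t1" "expectation t1 = L A * p"
    unfolding t1_def L_def
    using prod[where a="?e" and b="\<lambda>_. 1" and c="?i 1" and d="\<lambda>_. 1" and e="\<lambda>_. 1", OF em(1,2) im em(2,2) ints(1) one(1) ind(1) one(1,1)]
    by (simp_all add: ind(2) C prob_space)
  have t2: "integrable M t2" "expectation t2 = (1 - p) * (1 - q) * L E"
    unfolding t2_def L_def
    using prod[where a="\<lambda>_. 1" and b="\<lambda>_. 1" and c="?i 0" and d="?i 0" and e="?e", OF em(2,2) im im em(1) one(1,1) ind(1) ind(1) ints(3)]
    by (simp_all add: ind(2) C D prob_space)
  have t3: "integrable M t3" "expectation t3 = L A * L B * (1 - p) * q * L E"
    unfolding t3_def L_def
    using prod[where a="?e" and b="?e" and c="?i 0" and d="?i 1" and e="?e", OF em(1,1) im im em(1) ints(1,2) ind(1) ind(1) ints(3)]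
    by (simp_all add: ind(2) C D)
  have "AE \<omega> in M. exp (- \<alpha> * R \<omega>) = t1 \<omega> + t2 \<omega> + t3 \<omega>"
    using C01 D01 by eventually_elim
      (auto simp: R_def t1_def t2_def t3_def exp_add[symmetric] algebra_simps)
  then have "L R = expectation (\<lambda>\<omega>. t1 \<omega> + t2 \<omega> + t3 \<omega>)"
    unfolding L_def using t1(1) t2(1) t3(1) \<open>random_variable borel R\<close> by (intro integral_cong_AE) auto
  also have "\<dots> = expectation t1 + expectation t2 + expectation t3"
    using t1(1) t2(1) t3(1) by simp
  also have "\<dots> = p * L A + (1 - p) * (1 - q + q * L B * L A) * L E"
    by (simp add: t1(2) t2(2) t3(2) algebra_simps)
  finally show "L R = p * L A + (1 - p) * (1 - q + q * L B * L A) * L E" .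
qed

section \<open>The exponents of the storage model\<close>

context up_down_storage
begin

text \<open>Positivity of the mean has to be checked first: the logarithm of \<open>0\<close> is \<open>0\<close>, so the exponent alone
  does not exclude it.\<close>

lemma up_laplace_transform:
  assumes "0 \<le> \<alpha>"
  shows "expectation (\<lambda>\<omega>. exp (- \<alpha> * X\<^sub>u 1 \<omega>)) = exp (up_exponent c\<^sub>u \<sigma>\<^sub>u \<nu>\<^sub>u \<alpha>)"
proof -
  have "expectation (\<lambda>\<omega>. exp (- \<alpha> * X\<^sub>u 1 \<omega>)) \<noteq> 0"
    using integral_nonneg_eq_0_iff_AE[OF up_laplace(1)[OF assms]] by (simp add: AE_False)
  then have "0 < expectation (\<lambda>\<omega>. exp (- \<alpha> * X\<^sub>u 1 \<omega>))"
    by (simp add: order_less_le)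
  then show ?thesis by (simp flip: up_laplace(2)[OF assms])
qed

lemma up_slope:
  shows "((\<lambda>\<alpha>. up_exponent c\<^sub>u \<sigma>\<^sub>u \<nu>\<^sub>u \<alpha> / \<alpha>) \<longlongrightarrow> right_deriv_0 (up_exponent c\<^sub>u \<sigma>\<^sub>u \<nu>\<^sub>u)) (at_right 0)"
    and "0 < right_deriv_0 (up_exponent c\<^sub>u \<sigma>\<^sub>u \<nu>\<^sub>u)"
proof -
  have slope: "((\<lambda>\<alpha>. up_exponent c\<^sub>u \<sigma>\<^sub>u \<nu>\<^sub>u \<alpha> / \<alpha>) \<longlongrightarrow> - expectation (X\<^sub>u 1)) (at_right 0)"
    using up_laplace(1)[of 1] by (intro laplace_exponent_slope up_mean up_laplace_transform prob_space_axioms) simp_all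
  then have "right_deriv_0 (up_exponent c\<^sub>u \<sigma>\<^sub>u \<nu>\<^sub>u) = - expectation (X\<^sub>u 1)"
    by (rule right_deriv_0_eq) (simp add: up_exponent_def set_lebesgue_integral_def)
  with slope up_mean(2) show "((\<lambda>\<alpha>. up_exponent c\<^sub>u \<sigma>\<^sub>u \<nu>\<^sub>u \<alpha> / \<alpha>) \<longlongrightarrow> right_deriv_0 (up_exponent c\<^sub>u \<sigma>\<^sub>u \<nu>\<^sub>u)) (at_right 0)"
    "0 < right_deriv_0 (up_exponent c\<^sub>u \<sigma>\<^sub>u \<nu>\<^sub>u)" by simp_all
qed

lemma down_slope:
  shows "integrable \<nu>\<^sub>d (\<lambda>x. x)"
    and "right_deriv_0 (down_exponent c\<^sub>d \<nu>\<^sub>d) = c\<^sub>d + (LINT x|\<nu>\<^sub>d. x)"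
proof -
  \<comment> \<open>A non-integrable function has integral \<open>0\<close>, which the exponential on the right-hand side
    excludes.\<close>
  have "expectation (\<lambda>\<omega>. exp (- 1 * X\<^sub>d 1 \<omega>)) \<noteq> 0"
    using down_laplace[of 1] by simp
  then have "integrable M (\<lambda>\<omega>. exp (- X\<^sub>d 1 \<omega>))"
    using not_integrable_integral_eq by fastforce
  then have "((\<lambda>\<alpha>. - down_exponent c\<^sub>d \<nu>\<^sub>d \<alpha> / \<alpha>) \<longlongrightarrow> - expectation (X\<^sub>d 1)) (at_right 0)"
    by (intro laplace_exponent_slope down_mean down_laplace prob_space_axioms)
  from tendsto_minus[OF this]
  have slope: "((\<lambda>\<alpha>. down_exponent c\<^sub>d \<nu>\<^sub>d \<alpha> / \<alpha>) \<longlongrightarrow> expectation (X\<^sub>d 1)) (at_right 0)" by simp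
  show "integrable \<nu>\<^sub>d (\<lambda>x. x)"
    by (rule down_exponent_slope(1)[OF down_levy_measure slope])
  have "right_deriv_0 (down_exponent c\<^sub>d \<nu>\<^sub>d) = expectation (X\<^sub>d 1)"
    using slope by (rule right_deriv_0_eq) (simp add: down_exponent_def set_lebesgue_integral_def)
  then show "right_deriv_0 (down_exponent c\<^sub>d \<nu>\<^sub>d) = c\<^sub>d + (LINT x|\<nu>\<^sub>d. x)"
    using down_exponent_slope(2)[OF down_levy_measure slope] by simp
qed

lemma up_supremum:
  defines "\<phi> \<equiv> up_exponent c\<^sub>u \<sigma>\<^sub>u \<nu>\<^sub>u"
  shows "(\<lambda>\<omega>. SUP s\<in>{0..}. X\<^sub>u s \<omega>) \<in> borel_measurable M"
    and "AE \<omega> in M. 0 \<le> (SUP s\<in>{0..}. X\<^sub>u s \<omega>)"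
    and "0 < \<alpha> \<Longrightarrow> expectation (\<lambda>\<omega>. exp (- \<alpha> * (SUP s\<in>{0..}. X\<^sub>u s \<omega>))) = right_deriv_0 \<phi> * \<alpha> / \<phi> \<alpha>"
proof -
  have "levy_process M F X\<^sub>u"
    by (rule levy_process_fst[OF prob_space_axioms sets_F_subset space_F levy])
  note sup = levy_supremum[OF this up_laplace(1) up_laplace_transform up_slope(2,1)
      up_exponent_quadratic_growth[OF up_levy_measure]]
  show "(\<lambda>\<omega>. SUP s\<in>{0..}. X\<^sub>u s \<omega>) \<in> borel_measurable M" by (rule sup(1))
  show "AE \<omega> in M. 0 \<le> (SUP s\<in>{0..}. X\<^sub>u s \<omega>)" by (rule sup(2))
  show "expectation (\<lambda>\<omega>. exp (- \<alpha> * (SUP s\<in>{0..}. X\<^sub>u s \<omega>))) = right_deriv_0 \<phi> * \<alpha> / \<phi> \<alpha>" if "0 < \<alpha>"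
    using sup(3)[OF _ _ _ that] by (simp add: \<phi>_def mult.commute)
qed

end

section \<open>The decomposition of the stationary content\<close>

theorem theorem3:
  fixes M :: "'a measure" and F :: "ennreal \<Rightarrow> 'a measure"
    and X\<^sub>u X\<^sub>d :: "real \<Rightarrow> 'a \<Rightarrow> real"
    and c\<^sub>u \<sigma>\<^sub>u c\<^sub>d :: real and \<nu>\<^sub>u \<nu>\<^sub>d :: "real measure"
    and T S :: "nat \<Rightarrow> 'a \<Rightarrow> ennreal"
    and W\<^sub>0 :: "'a \<Rightarrow> real"
    and J W :: "real \<Rightarrow> 'a \<Rightarrow> real"
    and \<phi> \<eta> :: "real \<Rightarrow> real"
    and \<phi>' \<eta>' p\<^sub>d \<pi>\<^sub>l \<pi> :: real
    and Q :: "'b measure" and W\<^sub>i\<^sub>n\<^sub>f :: "'b \<Rightarrow> real"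
    and P :: "'c measure" and W\<^sub>u Y\<^sub>e I\<^sub>l I W\<^sub>d :: "'c \<Rightarrow> real"
  assumes model: "up_down_storage M F X\<^sub>u X\<^sub>d c\<^sub>u \<sigma>\<^sub>u \<nu>\<^sub>u c\<^sub>d \<nu>\<^sub>d T S W\<^sub>0"
    and J_eq: "J = (\<lambda>t \<omega>. down_indicator (\<lambda>n. T n \<omega>) (\<lambda>n. S n \<omega>) t)"
    and W_eq: "W = (\<lambda>t \<omega>. storage_content (\<lambda>n. T n \<omega>) (\<lambda>n. S n \<omega>) (\<lambda>s. X\<^sub>u s \<omega>) (\<lambda>s. X\<^sub>d s \<omega>) (W\<^sub>0 \<omega>) t)"
    and \<phi>_eq: "\<phi> = up_exponent c\<^sub>u \<sigma>\<^sub>u \<nu>\<^sub>u" and \<phi>'_eq: "\<phi>' = right_deriv_0 \<phi>"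
    and \<eta>_eq: "\<eta> = down_exponent c\<^sub>d \<nu>\<^sub>d" and \<eta>'_eq: "\<eta>' = right_deriv_0 \<eta>"
    and \<pi>\<^sub>l_eq: "\<pi>\<^sub>l = 1 - (1 + \<eta>' / \<phi>') * p\<^sub>d"
    and \<pi>_eq: "\<pi> = \<eta>' / (\<eta>' + \<phi>')"
    and W\<^sub>i\<^sub>n\<^sub>f_rv: "prob_space Q" "W\<^sub>i\<^sub>n\<^sub>f \<in> borel_measurable Q"
      "\<And>\<alpha>. 0 \<le> \<alpha> \<Longrightarrow> integrable Q (\<lambda>\<omega>. exp (- \<alpha> * W\<^sub>i\<^sub>n\<^sub>f \<omega>))"
    and W\<^sub>i\<^sub>n\<^sub>f_limit: "\<And>\<alpha>. 0 \<le> \<alpha> \<Longrightarrow> AE \<omega> in M.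
      ((\<lambda>t. 1 / t * (LINT s:{0..t}|lborel. exp (- \<alpha> * W s \<omega>)))
        \<longlongrightarrow> (\<integral>\<omega>. exp (- \<alpha> * W\<^sub>i\<^sub>n\<^sub>f \<omega>) \<partial>Q)) at_top"
    and p\<^sub>d_limit: "AE \<omega> in M. ((\<lambda>t. 1 / t * (LINT s:{0..t}|lborel. J s \<omega>)) \<longlongrightarrow> p\<^sub>d) at_top"
    and p\<^sub>d_le: "p\<^sub>d \<le> \<phi>' / (\<eta>' + \<phi>')"
    and P: "prob_space P"
    and indep: "prob_space.indep_vars P (\<lambda>_. borel) (\<lambda>i. [W\<^sub>u, Y\<^sub>e, I\<^sub>l, I, W\<^sub>d] ! i) {..<5}"
    and W\<^sub>d_nonneg: "AE \<omega> in P. 0 \<le> W\<^sub>d \<omega>"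
    and W\<^sub>d_limit: "\<And>\<alpha>. 0 < p\<^sub>d \<Longrightarrow> 0 \<le> \<alpha> \<Longrightarrow> AE \<omega> in M.
      ((\<lambda>t. (LINT s:{0..t}|lborel. exp (- \<alpha> * W s \<omega>) * J s \<omega>) / (LINT s:{0..t}|lborel. J s \<omega>))
        \<longlongrightarrow> (\<integral>\<omega>. exp (- \<alpha> * W\<^sub>d \<omega>) \<partial>P)) at_top"
    and W\<^sub>u_law: "distr P borel W\<^sub>u = distr M borel (\<lambda>\<omega>. SUP s\<in>{0..}. X\<^sub>u s \<omega>)"
    and Y\<^sub>e_law: "\<eta>' \<noteq> 0 \<Longrightarrow> cdf (distr P borel Y\<^sub>e) = excess_cdf c\<^sub>d \<nu>\<^sub>d"
      "\<eta>' = 0 \<Longrightarrow> AE \<omega> in P. 0 \<le> Y\<^sub>e \<omega>"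
    and I\<^sub>l_law: "measure P {\<omega> \<in> space P. I\<^sub>l \<omega> = 1} = \<pi>\<^sub>l"
      "measure P {\<omega> \<in> space P. I\<^sub>l \<omega> = 0} = 1 - \<pi>\<^sub>l"
    and I_law: "measure P {\<omega> \<in> space P. I \<omega> = 1} = \<pi>"
      "measure P {\<omega> \<in> space P. I \<omega> = 0} = 1 - \<pi>"
  shows "(\<forall>\<alpha>>0. (\<integral>\<omega>. exp (- \<alpha> * W\<^sub>i\<^sub>n\<^sub>f \<omega>) \<partial>Q) =
            \<pi>\<^sub>l * (\<phi>' * \<alpha> / \<phi> \<alpha>) +
            (1 - \<pi>\<^sub>l) * (1 - \<pi> + \<pi> * (\<eta> \<alpha> / (\<eta>' * \<alpha>)) * (\<phi>' * \<alpha> / \<phi> \<alpha>)) *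
              (\<integral>\<omega>. exp (- \<alpha> * W\<^sub>d \<omega>) \<partial>P))
    \<longleftrightarrow>
         distr Q borel W\<^sub>i\<^sub>n\<^sub>f =
         distr P borel (\<lambda>\<omega>. I\<^sub>l \<omega> * W\<^sub>u \<omega> + (1 - I\<^sub>l \<omega>) * (I \<omega> * (W\<^sub>u \<omega> + Y\<^sub>e \<omega>) + W\<^sub>d \<omega>))"
proof -
  interpret model: up_down_storage M F X\<^sub>u X\<^sub>d c\<^sub>u \<sigma>\<^sub>u \<nu>\<^sub>u c\<^sub>d \<nu>\<^sub>d T S W\<^sub>0 by (rule model)
  interpret P: prob_space P by (rule P)
  interpret Q: prob_space Q by (rule W\<^sub>i\<^sub>n\<^sub>f_rv(1))
  have lt5: "{..<5::nat} = {0, 1, 2, 3, 4}" by auto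
  have "\<forall>i\<in>{..<5::nat}. [W\<^sub>u, Y\<^sub>e, I\<^sub>l, I, W\<^sub>d] ! i \<in> borel_measurable P"
    using indep by (auto simp: P.indep_vars_def2)
  then have [measurable]: "W\<^sub>u \<in> borel_measurable P" "Y\<^sub>e \<in> borel_measurable P"
    by (simp_all add: lt5)
  note sup = model.up_supremum
  have sup_meas [measurable]: "(\<lambda>\<omega>. SUP s\<in>{0..}. X\<^sub>u s \<omega>) \<in> borel_measurable M" by (rule sup(1))
  have W\<^sub>u_nonneg: "AE \<omega> in P. 0 \<le> W\<^sub>u \<omega>"
  proof -
    have "AE x in distr M borel (\<lambda>\<omega>. SUP s\<in>{0..}. X\<^sub>u s \<omega>). 0 \<le> x"
      using sup(2) by (subst AE_distr_iff) auto
    then have "AE x in distr P borel W\<^sub>u. 0 \<le> x" by (simp only: W\<^sub>u_law)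
    then show ?thesis by (subst (asm) AE_distr_iff) auto
  qed
  have W\<^sub>u_transform: "(\<integral>\<omega>. exp (- \<alpha> * W\<^sub>u \<omega>) \<partial>P) = \<phi>' * \<alpha> / \<phi> \<alpha>" if "0 < \<alpha>" for \<alpha>
  proof -
    have "(\<integral>\<omega>. exp (- \<alpha> * W\<^sub>u \<omega>) \<partial>P) = (\<integral>x. exp (- \<alpha> * x) \<partial>distr P borel W\<^sub>u)"
      by (subst integral_distr) auto
    also have "\<dots> = (\<integral>x. exp (- \<alpha> * x) \<partial>distr M borel (\<lambda>\<omega>. SUP s\<in>{0..}. X\<^sub>u s \<omega>))"
      by (simp only: W\<^sub>u_law)
    also have "\<dots> = (\<integral>\<omega>. exp (- \<alpha> * (SUP s\<in>{0..}. X\<^sub>u s \<omega>)) \<partial>M)"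
      by (subst integral_distr) auto
    also have "\<dots> = \<phi>' * \<alpha> / \<phi> \<alpha>"
      unfolding \<phi>'_eq \<phi>_eq by (rule sup(3)) (fact that)
    finally show ?thesis .
  qed
  have \<eta>'_formula: "\<eta>' = c\<^sub>d + (LINT x|\<nu>\<^sub>d. x)"
    unfolding \<eta>'_eq \<eta>_eq by (rule model.down_slope(2))
  have "AE x in \<nu>\<^sub>d. 0 < x"
    using model.down_levy_measure by (intro AE_levy_pos) (auto simp: subordinator_levy_measure_def)
  then have "0 \<le> (LINT x|\<nu>\<^sub>d. x)" by (intro integral_nonneg_AE) (auto elim!: eventually_mono)
  then have "0 \<le> \<eta>'" using model.down_drift \<eta>'_formula by simp
  have law: "AE y in distr P borel Y\<^sub>e. 0 \<le> y"
      "0 < \<alpha> \<Longrightarrow> (LINT y|distr P borel Y\<^sub>e. exp (- \<alpha> * y)) = \<eta> \<alpha> / (\<eta>' * \<alpha>)" if "\<eta>' \<noteq> 0" for \<alpha>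
    unfolding \<eta>_eq
    using excess_law[OF model.down_levy_measure model.down_slope(1) model.down_drift \<eta>'_formula _ _ Y\<^sub>e_law(1)[OF that]]
      that \<open>0 \<le> \<eta>'\<close> by (auto intro!: P.real_distribution_distr)
  have Y\<^sub>e_nonneg: "AE \<omega> in P. 0 \<le> Y\<^sub>e \<omega>"
  proof (cases "\<eta>' = 0")
    case False
    from law(1)[OF this] show ?thesis by (subst (asm) AE_distr_iff) auto
  qed (rule Y\<^sub>e_law(2))
  \<comment> \<open>The factor \<open>\<pi>\<close> covers the case \<open>\<eta>' = 0\<close>, where both sides vanish.\<close>
  have Y\<^sub>e_transform: "\<pi> * (\<integral>\<omega>. exp (- \<alpha> * Y\<^sub>e \<omega>) \<partial>P) = \<pi> * (\<eta> \<alpha> / (\<eta>' * \<alpha>))" if "0 < \<alpha>" for \<alpha>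
  proof (cases "\<eta>' = 0")
    case False
    have "(\<integral>\<omega>. exp (- \<alpha> * Y\<^sub>e \<omega>) \<partial>P) = (LINT y|distr P borel Y\<^sub>e. exp (- \<alpha> * y))"
      by (subst integral_distr) auto
    with law(2)[OF False that] show ?thesis by simp
  qed (simp add: \<pi>_eq)
  define R where "R = (\<lambda>\<omega>. I\<^sub>l \<omega> * W\<^sub>u \<omega> + (1 - I\<^sub>l \<omega>) * (I \<omega> * (W\<^sub>u \<omega> + Y\<^sub>e \<omega>) + W\<^sub>d \<omega>))"
  note mixture = P.mixture_laplace_transform[OF indep W\<^sub>u_nonneg Y\<^sub>e_nonneg W\<^sub>d_nonneg I\<^sub>l_law I_law]
  have [measurable]: "R \<in> borel_measurable P" unfolding R_def by (rule mixture(1)[OF zero_less_one])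
  have R_nonneg: "AE \<omega> in P. 0 \<le> R \<omega>" unfolding R_def by (rule mixture(2)[OF zero_less_one])
  have R_transform: "(\<integral>\<omega>. exp (- \<alpha> * R \<omega>) \<partial>P) = \<pi>\<^sub>l * (\<phi>' * \<alpha> / \<phi> \<alpha>) +
      (1 - \<pi>\<^sub>l) * (1 - \<pi> + \<pi> * (\<eta> \<alpha> / (\<eta>' * \<alpha>)) * (\<phi>' * \<alpha> / \<phi> \<alpha>)) *
        (\<integral>\<omega>. exp (- \<alpha> * W\<^sub>d \<omega>) \<partial>P)" if "0 < \<alpha>" for \<alpha>
    unfolding R_def using mixture(3)[OF that] by (simp only: W\<^sub>u_transform[OF that] Y\<^sub>e_transform[OF that])
  have "(\<forall>\<alpha>>0. (\<integral>\<omega>. exp (- \<alpha> * W\<^sub>i\<^sub>n\<^sub>f \<omega>) \<partial>Q) = (\<integral>\<omega>. exp (- \<alpha> * R \<omega>) \<partial>P)) \<longleftrightarrow>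
      distr Q borel W\<^sub>i\<^sub>n\<^sub>f = distr P borel R"
    by (rule laplace_transforms_eq_iff_distr_eq) (use Q.prob_space_axioms P.prob_space_axioms W\<^sub>i\<^sub>n\<^sub>f_rv R_nonneg in simp_all)
  then show ?thesis
    unfolding R_def[symmetric] using R_transform by simp
qed

end
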